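(* For a finite simple graph $G$ the following are equivalent: (i) $G$ is a hereditary unigraph; (ii) $G$ contains none of the configurations (a), (b), (c), (d) described below; (iii) $G$ is $\mathcal{F}$-free, where $\mathcal{F}$ is the set of sixteen graphs described below.
   Context: All graphs are finite and simple. A unigraph is a graph $G$ such that every graph with the same degree sequence as $G$ is isomorphic to $G$; a hereditary unigraph is a graph all of whose induced subgraphs are unigraphs. A graph is $\mathcal{F}$-free if none of its induced subgraphs is isomorphic to a member of $\mathcal{F}$. A configuration is a triple $(V,E,F)$ with $(V,E)$ a graph and $F$ a set of vertex pairs not in $E$ (non-edges); $G$ contains it if there is an injection $f:V\to V(G)$ with $f(x)f(y)\in E(G)$ for all $xy\in E$ and $f(x)f(y)\notin E(G)$ for all $xy\in F$ (other pairs unconstrained). The configurations are: (a) vertices $p,q,r,s,w$; edges $pq,rs,qw,rw$; non-edges $qr,ps,pw,sw$. (b) vertices $p,q,r,s,w$; edges $pq,rs,pw,qw$; non-edges $qr,ps,rw,sw$. (c) vertices $p,q,r,s,y,z$; edges $pq,rs,pz,qy$; non-edges $qr,ps,rz,sy$. (d) vertices $p,q,r,s,y,z$; edges $pq,rs,ry,qz$; non-edges $qr,ps,py,sz$. The set $\mathcal{F}$ consists of: $P_5$; the house $\overline{P_5}$ (a 4-cycle plus a vertex adjacent to two adjacent cycle vertices); $K_2+K_3$; $K_{2,3}$; the 4-pan (a 4-cycle with a pendant vertex attached to one cycle vertex); the co-4-pan (its complement); $2P_3$; $(K_2+K_1)\vee(K_2+K_1)$; $K_2+P_4$; $2K_1\vee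 P_4$; $K_2+C_4$; $2K_1\vee 2K_2$; the graph $X_1$ on vertices $p,q,r,s,t,u$ with edge set $\{pq,pr,pt,pu,qu,ru,rs\}$; the graph $X_2$ obtained from $X_1$ by adding the edge $tu$; and the complements $\overline{X_1}$, $\overline{X_2}$. Here $+$ denotes disjoint union, $\vee$ denotes join, and $kH$ denotes $k$ disjoint copies of $H$. *)

theory Defs
  imports Main "HOL-Library.Multiset"
begin

record 'a ugraph =
  uverts :: "'a set"
  uedges :: "'a set set"

definition fin_graph :: "'a ugraph \<Rightarrow> bool" where
  "fin_graph G \<longleftrightarrow> finite (uverts G) \<and>
     uedges G \<subseteq> {{x, y} | x y. x \<in> uverts G \<and> y \<in> uverts G \<and> x \<noteq> y}"

definition graph_iso :: "'a ugraph \<Rightarrow> 'b ugraph \<Rightarrow> bool" where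
  "graph_iso G H \<longleftrightarrow> (\<exists>f. bij_betw f (uverts G) (uverts H) \<and>
     (\<forall>x\<in>uverts G. \<forall>y\<in>uverts G. {x, y} \<in> uedges G \<longleftrightarrow> {f x, f y} \<in> uedges H))"

definition induced :: "'a ugraph \<Rightarrow> 'a set \<Rightarrow> 'a ugraph" where
  "induced G S = \<lparr>uverts = S, uedges = {e \<in> uedges G. e \<subseteq> S}\<rparr>"

definition vdegree :: "'a ugraph \<Rightarrow> 'a \<Rightarrow> nat" where
  "vdegree G x = card {y \<in> uverts G. {x, y} \<in> uedges G}"

text \<open>The degree sequence is the list of all vertex degrees in nonincreasing order.\<close>

definition degree_seq :: "'a ugraph \<Rightarrow> nat list" where
  "degree_seq G = rev (sorted_list_of_multiset (image_mset (vdegree G) (mset_set (uverts G))))"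

text \<open>A definition cannot quantify over all vertex types. Every finite graph is isomorphic to one
  with vertices in \<^typ>\<open>nat\<close>, so competitors on \<^typ>\<open>nat\<close> suffice; see
  \<open>unigraph_iso\<close> below for competitors on an arbitrary type.\<close>

definition unigraph :: "'a ugraph \<Rightarrow> bool" where
  "unigraph G \<longleftrightarrow> fin_graph G \<and>
     (\<forall>H :: nat ugraph. fin_graph H \<and> degree_seq H = degree_seq G \<longrightarrow> graph_iso H G)"

definition hereditary_unigraph :: "'a ugraph \<Rightarrow> bool" where
  "hereditary_unigraph G \<longleftrightarrow> (\<forall>S. S \<subseteq> uverts G \<longrightarrow> unigraph (induced G S))"

definition graph_free :: "'b ugraph set \<Rightarrow> 'a ugraph \<Rightarrow> bool" where
  "graph_free \<F> G \<longleftrightarrow> \<not> (\<exists>S H. S \<subseteq> uverts G \<and> H \<in> \<F> \<and> graph_iso (induced G S) H)"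

definition relabel :: "('a \<Rightarrow> 'b) \<Rightarrow> 'a ugraph \<Rightarrow> 'b ugraph" where
  "relabel f G = \<lparr>uverts = f ` uverts G, uedges = (\<lambda>e. f ` e) ` uedges G\<rparr>"

lemma edge_relabel_iff:
  assumes "fin_graph G" "inj_on f (uverts G)" "x \<in> uverts G" "y \<in> uverts G"
  shows "{f x, f y} \<in> uedges (relabel f G) \<longleftrightarrow> {x, y} \<in> uedges G"
proof
  assume "{f x, f y} \<in> uedges (relabel f G)"
  then obtain e where e: "e \<in> uedges G" "f ` e = f ` {x, y}"
    by (auto simp: relabel_def)
  moreover have "e \<subseteq> uverts G" using assms(1) e(1) by (auto simp: fin_graph_def)
  ultimately have "e = {x, y}"
    using inj_on_image_eq_iff[OF assms(2), of e "{x, y}"] assms(3,4) by simp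
  with e show "{x, y} \<in> uedges G" by simp
next
  assume "{x, y} \<in> uedges G"
  then have "f ` {x, y} \<in> uedges (relabel f G)"
    unfolding relabel_def ugraph.select_convs by (rule imageI)
  then show "{f x, f y} \<in> uedges (relabel f G)" by simp
qed

lemma fin_graph_relabel:
  assumes "fin_graph G" "inj_on f (uverts G)"
  shows "fin_graph (relabel f G)"
proof -
  have "\<exists>x y. f ` e = {x, y} \<and> x \<in> f ` uverts G \<and> y \<in> f ` uverts G \<and> x \<noteq> y"
    if e: "e \<in> uedges G" for e
  proof -
    obtain x y where xy: "e = {x, y}" "x \<in> uverts G" "y \<in> uverts G" "x \<noteq> y"
      using assms(1) e unfolding fin_graph_def by blast
    then have "f ` e = {f x, f y}" "f x \<noteq> f y" using assms(2) by (auto dest: inj_onD)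
    with xy show ?thesis by blast
  qed
  then show ?thesis using assms(1) by (auto simp: fin_graph_def relabel_def)
qed

lemma vdegree_relabel:
  assumes "fin_graph G" "inj_on f (uverts G)" "x \<in> uverts G"
  shows "vdegree (relabel f G) (f x) = vdegree G x"
proof -
  have "{y \<in> uverts (relabel f G). {f x, y} \<in> uedges (relabel f G)}
      = f ` {y \<in> uverts G. {x, y} \<in> uedges G}" (is "?A = f ` ?B")
    using edge_relabel_iff[OF assms(1,2,3)] by (auto simp: relabel_def)
  moreover have "inj_on f ?B" using assms(2) by (rule inj_on_subset) auto
  ultimately show ?thesis by (simp add: vdegree_def card_image)
qed

lemma degree_seq_relabel:
  assumes "fin_graph G" "inj_on f (uverts G)"
  shows "degree_seq (relabel f G) = degree_seq G"
proof -
  have "mset_set (uverts (relabel f G)) = image_mset f (mset_set (uverts G))"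
    using image_mset_mset_set[OF assms(2)] by (simp add: relabel_def)
  moreover have "image_mset (\<lambda>x. vdegree (relabel f G) (f x)) (mset_set (uverts G))
      = image_mset (vdegree G) (mset_set (uverts G))"
    using assms by (intro image_mset_cong) (auto simp: vdegree_relabel fin_graph_def)
  ultimately show ?thesis by (simp add: degree_seq_def multiset.map_comp comp_def)
qed

lemma unigraph_iso:
  fixes G :: "'a ugraph" and H :: "'b ugraph"
  assumes "unigraph G" "fin_graph H" "degree_seq H = degree_seq G"
  shows "graph_iso H G"
proof -
  obtain f :: "'b \<Rightarrow> nat" where f: "inj_on f (uverts H)"
    using assms(2) finite_imp_inj_to_nat_seg[of "uverts H"] by (auto simp: fin_graph_def)
  have "graph_iso (relabel f H) G"
    using assms f by (auto simp: unigraph_def fin_graph_relabel degree_seq_relabel)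
  then obtain g where g: "bij_betw g (f ` uverts H) (uverts G)"
    and e: "\<forall>x\<in>f ` uverts H. \<forall>y\<in>f ` uverts H.
      {x, y} \<in> uedges (relabel f H) \<longleftrightarrow> {g x, g y} \<in> uedges G"
    by (auto simp: graph_iso_def relabel_def)
  have "bij_betw (g \<circ> f) (uverts H) (uverts G)"
    using f g by (auto intro!: bij_betw_trans inj_on_imp_bij_betw)
  moreover have "\<forall>x\<in>uverts H. \<forall>y\<in>uverts H.
      {x, y} \<in> uedges H \<longleftrightarrow> {(g \<circ> f) x, (g \<circ> f) y} \<in> uedges G"
    using e edge_relabel_iff[OF assms(2) f] by simp
  ultimately show ?thesis unfolding graph_iso_def by blast
qed


record 'a configuration =
  cverts :: "'a set"
  cedges :: "'a set set"
  cnonedges :: "'a set set"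

definition is_configuration :: "'a configuration \<Rightarrow> bool" where
  "is_configuration C \<longleftrightarrow> fin_graph \<lparr>uverts = cverts C, uedges = cedges C\<rparr> \<and>
     cnonedges C \<subseteq> {{x, y} | x y. x \<in> cverts C \<and> y \<in> cverts C \<and> x \<noteq> y} - cedges C"

definition contains_config :: "'a ugraph \<Rightarrow> 'b configuration \<Rightarrow> bool" where
  "contains_config G C \<longleftrightarrow> (\<exists>f. inj_on f (cverts C) \<and> f ` cverts C \<subseteq> uverts G \<and>
     (\<forall>e\<in>cedges C. f ` e \<in> uedges G) \<and> (\<forall>e\<in>cnonedges C. f ` e \<notin> uedges G))"

definition config_a :: "nat configuration" where
  "config_a = (let p = 0; q = 1; r = 2; s = 3; w = 4 in
     \<lparr>cverts = {p, q, r, s, w},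
      cedges = {{p, q}, {r, s}, {q, w}, {r, w}},
      cnonedges = {{q, r}, {p, s}, {p, w}, {s, w}}\<rparr>)"

definition config_b :: "nat configuration" where
  "config_b = (let p = 0; q = 1; r = 2; s = 3; w = 4 in
     \<lparr>cverts = {p, q, r, s, w},
      cedges = {{p, q}, {r, s}, {p, w}, {q, w}},
      cnonedges = {{q, r}, {p, s}, {r, w}, {s, w}}\<rparr>)"

definition config_c :: "nat configuration" where
  "config_c = (let p = 0; q = 1; r = 2; s = 3; y = 4; z = 5 in
     \<lparr>cverts = {p, q, r, s, y, z},
      cedges = {{p, q}, {r, s}, {p, z}, {q, y}},
      cnonedges = {{q, r}, {p, s}, {r, z}, {s, y}}\<rparr>)"

definition config_d :: "nat configuration" where
  "config_d = (let p = 0; q = 1; r = 2; s = 3; y = 4; z = 5 in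
     \<lparr>cverts = {p, q, r, s, y, z},
      cedges = {{p, q}, {r, s}, {r, y}, {q, z}},
      cnonedges = {{q, r}, {p, s}, {p, y}, {s, z}}\<rparr>)"

lemma is_configuration_abcd:
  "is_configuration config_a" "is_configuration config_b"
  "is_configuration config_c" "is_configuration config_d"
proof -
  have *: "{a, b} \<in> {{x, y} | x y. x \<in> V \<and> y \<in> V \<and> x \<noteq> y} \<longleftrightarrow> a \<in> V \<and> b \<in> V \<and> a \<noteq> b"
    for a b :: nat and V
    by (auto simp: doubleton_eq_iff)
  show "is_configuration config_a" "is_configuration config_b"
    "is_configuration config_c" "is_configuration config_d"
    unfolding is_configuration_def fin_graph_def config_a_def config_b_def config_c_def
      config_d_def Let_def ugraph.select_convs configuration.select_convs
      insert_subset Diff_iff *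
    by (simp_all add: doubleton_eq_iff)
qed


definition complement :: "'a ugraph \<Rightarrow> 'a ugraph" where
  "complement G = \<lparr>uverts = uverts G,
     uedges = {{x, y} | x y. x \<in> uverts G \<and> y \<in> uverts G \<and> x \<noteq> y} - uedges G\<rparr>"

text \<open>Disjoint union and join stay inside \<^typ>\<open>nat\<close>: the first operand is moved to the even
  numbers, the second to the odd numbers.\<close>

definition disj_union :: "nat ugraph \<Rightarrow> nat ugraph \<Rightarrow> nat ugraph" where
  "disj_union G H =
     (let G' = relabel (\<lambda>x. 2 * x) G; H' = relabel (\<lambda>x. 2 * x + 1) H in
      \<lparr>uverts = uverts G' \<union> uverts H', uedges = uedges G' \<union> uedges H'\<rparr>)"

definition join :: "nat ugraph \<Rightarrow> nat ugraph \<Rightarrow> nat ugraph" where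
  "join G H =
     (let G' = relabel (\<lambda>x. 2 * x) G; H' = relabel (\<lambda>x. 2 * x + 1) H in
      \<lparr>uverts = uverts G' \<union> uverts H',
       uedges = uedges G' \<union> uedges H' \<union> {{x, y} | x y. x \<in> uverts G' \<and> y \<in> uverts H'}\<rparr>)"

primrec copies :: "nat \<Rightarrow> nat ugraph \<Rightarrow> nat ugraph" where
  "copies 0 H = \<lparr>uverts = {}, uedges = {}\<rparr>"
| "copies (Suc k) H = disj_union H (copies k H)"

definition path_graph :: "nat \<Rightarrow> nat ugraph" where
  "path_graph n = \<lparr>uverts = {..<n}, uedges = {{i, Suc i} | i. Suc i < n}\<rparr>"

text \<open>A cycle only for \<open>n \<ge> 3\<close>.\<close>

definition cycle_graph :: "nat \<Rightarrow> nat ugraph" where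
  "cycle_graph n = \<lparr>uverts = {..<n}, uedges = {{i, Suc i mod n} | i. i < n}\<rparr>"

definition complete_graph :: "nat \<Rightarrow> nat ugraph" where
  "complete_graph n = \<lparr>uverts = {..<n}, uedges = {{i, j} | i j. i < n \<and> j < n \<and> i \<noteq> j}\<rparr>"

definition complete_bipartite :: "nat \<Rightarrow> nat \<Rightarrow> nat ugraph" where
  "complete_bipartite m n =
     \<lparr>uverts = {..<m + n}, uedges = {{i, j} | i j. i < m \<and> m \<le> j \<and> j < m + n}\<rparr>"

definition four_pan :: "nat ugraph" where
  "four_pan = \<lparr>uverts = insert 4 (uverts (cycle_graph 4)),
               uedges = insert {0, 4} (uedges (cycle_graph 4))\<rparr>"

definition X1 :: "nat ugraph" where
  "X1 = (let p = 0; q = 1; r = 2; s = 3; t = 4; u = 5 in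
     \<lparr>uverts = {p, q, r, s, t, u},
      uedges = {{p, q}, {p, r}, {p, t}, {p, u}, {q, u}, {r, u}, {r, s}}\<rparr>)"

definition X2 :: "nat ugraph" where
  "X2 = (let t = 4; u = 5 in \<lparr>uverts = uverts X1, uedges = insert {t, u} (uedges X1)\<rparr>)"

definition forbidden :: "nat ugraph set" where
  "forbidden =
    {path_graph 5,
     complement (path_graph 5),
     disj_union (complete_graph 2) (complete_graph 3),
     complete_bipartite 2 3,
     four_pan,
     complement four_pan,
     copies 2 (path_graph 3),
     join (disj_union (complete_graph 2) (complete_graph 1))
          (disj_union (complete_graph 2) (complete_graph 1)),
     disj_union (complete_graph 2) (path_graph 4),
     join (copies 2 (complete_graph 1)) (path_graph 4),
     disj_union (complete_graph 2) (cycle_graph 4),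
     join (copies 2 (complete_graph 1)) (copies 2 (complete_graph 2)),
     X1,
     X2,
     complement X1,
     complement X2}"

end

theory Submission
  imports Defs
begin

text \<open>Any two graphs with the same vertices and degrees are joined by a sequence of 2-switches,
  which replace edges \<open>pq\<close>, \<open>rs\<close> by non-edges \<open>qr\<close>, \<open>ps\<close>. Without the configurations (a)--(d), every
  2-switch amounts to exchanging the names of two vertices, so every graph with the same degree
  sequence is isomorphic, and the condition passes to induced subgraphs. Conversely each of the
  sixteen forbidden graphs has a non-isomorphic companion with the same degree sequence, and each
  completion of one of the configurations to a graph induces a forbidden graph.\<close>

section \<open>Isomorphism invariants\<close>

text \<open>Every configuration consists of an alternating 4-cycle (edges pq, rs, non-edges qr, ps)
  together with witnesses that p, r differ in some neighbour off the cycle and that q, s do too; the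
  two witnesses coincide in (a) and (b) and are distinct in (c) and (d). Excluding all four
  therefore says that on every alternating 4-cycle one diagonal pair has the same neighbours off the
  cycle. This condition is invariant under isomorphism and so survives each switch of a sequence,
  and it is inherited by induced subgraphs, which being a unigraph is not.

  Complementation turns an alternating 4-cycle into another one, exchanges (a) with (b) and (c) with
  (d), and permutes the sixteen forbidden graphs; the case analyses for (b) and (d) mirror those for
  (a) and (c). Fourteen of the sixteen are each other's companions in seven pairs.\<close>

lemma graph_iso_sym:
  assumes "graph_iso G H"
  shows "graph_iso H G"
proof -
  obtain f where f: "bij_betw f (uverts G) (uverts H)"
    "\<forall>x\<in>uverts G. \<forall>y\<in>uverts G. {x, y} \<in> uedges G \<longleftrightarrow> {f x, f y} \<in> uedges H"
    using assms by (auto simp: graph_iso_def)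
  let ?g = "inv_into (uverts G) f"
  have "bij_betw ?g (uverts H) (uverts G)" using f(1) by (rule bij_betw_inv_into)
  moreover have "\<forall>x\<in>uverts H. \<forall>y\<in>uverts H. {x, y} \<in> uedges H \<longleftrightarrow> {?g x, ?g y} \<in> uedges G"
    using f bij_betw_inv_into_right[OF f(1)] bij_betw_apply[OF calculation] by simp
  ultimately show ?thesis unfolding graph_iso_def by blast
qed

lemma graph_iso_trans:
  assumes "graph_iso G H" "graph_iso H K"
  shows "graph_iso G K"
proof -
  obtain f g where f: "bij_betw f (uverts G) (uverts H)"
      "\<forall>x\<in>uverts G. \<forall>y\<in>uverts G. {x, y} \<in> uedges G \<longleftrightarrow> {f x, f y} \<in> uedges H"
    and g: "bij_betw g (uverts H) (uverts K)"
      "\<forall>x\<in>uverts H. \<forall>y\<in>uverts H. {x, y} \<in> uedges H \<longleftrightarrow> {g x, g y} \<in> uedges K"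
    using assms by (auto simp: graph_iso_def)
  have "bij_betw (g \<circ> f) (uverts G) (uverts K)" using f(1) g(1) by (rule bij_betw_trans)
  moreover have "\<forall>x\<in>uverts G. \<forall>y\<in>uverts G. {x, y} \<in> uedges G \<longleftrightarrow> {(g \<circ> f) x, (g \<circ> f) y} \<in> uedges K"
    using f g bij_betw_apply[OF f(1)] by simp
  ultimately show ?thesis unfolding graph_iso_def by blast
qed

lemma vdegree_iso:
  assumes f: "bij_betw f (uverts G) (uverts H)"
      "\<forall>x\<in>uverts G. \<forall>y\<in>uverts G. {x, y} \<in> uedges G \<longleftrightarrow> {f x, f y} \<in> uedges H"
    and x: "x \<in> uverts G"
  shows "vdegree H (f x) = vdegree G x"
proof -
  have "{y \<in> uverts H. {f x, y} \<in> uedges H} = f ` {y \<in> uverts G. {x, y} \<in> uedges G}"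
    using f x by (fastforce simp: bij_betw_def image_iff)
  moreover have "inj_on f {y \<in> uverts G. {x, y} \<in> uedges G}"
    using f(1) by (auto simp: bij_betw_def intro: inj_on_subset)
  ultimately show ?thesis by (simp add: vdegree_def card_image)
qed

lemma degree_seq_iso:
  assumes "graph_iso G H"
  shows "degree_seq G = degree_seq H"
proof -
  obtain f where f: "bij_betw f (uverts G) (uverts H)"
    "\<forall>x\<in>uverts G. \<forall>y\<in>uverts G. {x, y} \<in> uedges G \<longleftrightarrow> {f x, f y} \<in> uedges H"
    using assms by (auto simp: graph_iso_def)
  have "image_mset (vdegree G) (mset_set (uverts G))
    = image_mset (vdegree H \<circ> f) (mset_set (uverts G))"
    by (cases "finite (uverts G)") (auto intro!: image_mset_cong simp: vdegree_iso[OF f])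
  also have "\<dots> = image_mset (vdegree H) (mset_set (uverts H))"
    using f(1) by (metis bij_betw_def image_mset_mset_set multiset.map_comp)
  finally show ?thesis by (simp add: degree_seq_def)
qed

text \<open>The invariant that separates each forbidden graph from another graph with its degree
  sequence: which pairs of degrees occur at the two ends of an edge.\<close>

definition has_edge_degrees :: "'a ugraph \<Rightarrow> nat set \<Rightarrow> bool" where
  "has_edge_degrees G D \<longleftrightarrow> (\<exists>x\<in>uverts G. \<exists>y\<in>uverts G. {x, y} \<in> uedges G \<and>
    {vdegree G x, vdegree G y} = D)"

lemma has_edge_degrees_iso:
  assumes "graph_iso G H" "has_edge_degrees G D"
  shows "has_edge_degrees H D"
proof -
  obtain f where f: "bij_betw f (uverts G) (uverts H)"
    "\<forall>x\<in>uverts G. \<forall>y\<in>uverts G. {x, y} \<in> uedges G \<longleftrightarrow> {f x, f y} \<in> uedges H"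
    using assms by (auto simp: graph_iso_def)
  obtain x y where xy: "x \<in> uverts G" "y \<in> uverts G" "{x, y} \<in> uedges G"
    "{vdegree G x, vdegree G y} = D"
    using assms(2) by (auto simp: has_edge_degrees_def)
  show ?thesis unfolding has_edge_degrees_def
    using xy f bij_betw_apply[OF f(1)] vdegree_iso[OF f]
    by (intro bexI[of _ "f x"] bexI[of _ "f y"]) auto
qed

section \<open>Graphs presented by explicit lists\<close>

definition listed_adj :: "('a \<times> 'a) list \<Rightarrow> 'a \<Rightarrow> 'a \<Rightarrow> bool" where
  "listed_adj es x y \<longleftrightarrow> (x, y) \<in> set es \<or> (y, x) \<in> set es"

text \<open>Degrees and adjacencies of a listed graph are executable expressions, so concrete graphs
  can be compared by evaluation. An edge may occur repeatedly and in both orientations in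
  \<open>es\<close>, as it does in the lists built for complete graphs and complements.\<close>

definition listed :: "'a ugraph \<Rightarrow> 'a list \<Rightarrow> ('a \<times> 'a) list \<Rightarrow> bool" where
  "listed G xs es \<longleftrightarrow> distinct xs \<and> uverts G = set xs \<and> uedges G = (\<lambda>(x, y). {x, y}) ` set es \<and>
     (\<forall>(x, y)\<in>set es. x \<in> set xs \<and> y \<in> set xs \<and> x \<noteq> y)"

lemma listedD:
  assumes "listed G xs es"
  shows "distinct xs" "uverts G = set xs" "{x, y} \<in> uedges G \<longleftrightarrow> listed_adj es x y" "fin_graph G"
  using assms by (fastforce simp: listed_def listed_adj_def doubleton_eq_iff fin_graph_def)+

lemma vdegree_listed:
  assumes "listed G xs es"
  shows "vdegree G x = length (filter (listed_adj es x) xs)"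
  using listedD[OF assms] distinct_length_filter[of xs "listed_adj es x"]
  by (simp add: vdegree_def Int_def conj_commute)

lemma degree_seq_listed:
  assumes "listed G xs es"
  shows "degree_seq G = rev (sort (map (\<lambda>x. length (filter (listed_adj es x) xs)) xs))"
proof -
  have "mset_set (uverts G) = mset xs"
    using listedD[OF assms] by (simp add: mset_set_set)
  moreover have "vdegree G = (\<lambda>x. length (filter (listed_adj es x) xs))"
    using vdegree_listed[OF assms] by blast
  ultimately show ?thesis
    by (simp add: degree_seq_def flip: mset_map)
qed

lemma has_edge_degrees_listed:
  assumes "listed G xs es"
  shows "has_edge_degrees G D \<longleftrightarrow> (\<exists>(x, y)\<in>set es.
    {length (filter (listed_adj es x) xs), length (filter (listed_adj es y) xs)} = D)"
proof
  assume "has_edge_degrees G D"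
  then show "\<exists>(x, y)\<in>set es.
    {length (filter (listed_adj es x) xs), length (filter (listed_adj es y) xs)} = D"
    unfolding has_edge_degrees_def listedD(3)[OF assms] vdegree_listed[OF assms] listed_adj_def
    by (auto simp: insert_commute)
next
  assume "\<exists>(x, y)\<in>set es.
    {length (filter (listed_adj es x) xs), length (filter (listed_adj es y) xs)} = D"
  then show "has_edge_degrees G D"
    using assms unfolding has_edge_degrees_def vdegree_listed[OF assms]
    by (fastforce simp: listed_def)
qed

text \<open>Since \<open>A\<close> and \<open>B\<close> share their degree sequence, a unigraph
  isomorphic to one of them would be isomorphic to both; but only \<open>A\<close> has an edge whose
  end degrees form \<open>D\<close>. The disjunction in the last hypothesis lets one comparison
  dispose of both graphs.\<close>

lemma nonisomorphic_not_unigraph: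
  fixes A :: "nat ugraph" and B :: "nat ugraph"
  assumes A: "listed A xs es" and B: "listed B ys fs"
    and deg: "sort (map (\<lambda>x. length (filter (listed_adj es x) xs)) xs) =
              sort (map (\<lambda>x. length (filter (listed_adj fs x) ys)) ys)"
    and "\<exists>(x, y)\<in>set es. {length (filter (listed_adj es x) xs), length (filter
      (listed_adj es y) xs)} = D"
    and "\<not> (\<exists>(x, y)\<in>set fs. {length (filter (listed_adj fs x) ys), length (filter
      (listed_adj fs y) ys)} = D)"
    and "graph_iso K A \<or> graph_iso K B"
  shows "\<not> unigraph K"
proof
  assume K: "unigraph K"
  have "\<not> graph_iso A B"
    using assms(4,5) has_edge_degrees_iso[of A B D]
    unfolding has_edge_degrees_listed[OF A] has_edge_degrees_listed[OF B] by blast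
  moreover have "degree_seq A = degree_seq B"
    using deg by (simp add: degree_seq_listed[OF A] degree_seq_listed[OF B])
  then have "degree_seq A = degree_seq K" "degree_seq B = degree_seq K"
    using assms(6) degree_seq_iso[of K A] degree_seq_iso[of K B] by auto
  then have "graph_iso A K" "graph_iso B K"
    using unigraph_iso[OF K] listedD(4)[OF A] listedD(4)[OF B] by auto
  ultimately show False using graph_iso_trans graph_iso_sym by blast
qed

section \<open>Listings of the graph constructions\<close>

lemma listed_relabel:
  assumes "listed G xs es" "inj f"
  shows "listed (relabel f G) (map f xs) (map (map_prod f f) es)"
  using assms unfolding listed_def relabel_def
  by (auto simp: distinct_map inj_on_def image_image case_prod_unfold)

lemma listed_disj_union:
  assumes "listed G xs es" "listed H ys fs"
  shows "listed (disj_union G H) (map (\<lambda>x. 2 * x) xs @ map (\<lambda>x. 2 * x + 1) ys)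
    (map (map_prod (\<lambda>x. 2 * x) (\<lambda>x. 2 * x)) es @ map (map_prod (\<lambda>x. 2 * x + 1) (\<lambda>x. 2 * x + 1)) fs)"
proof -
  have "listed (relabel (\<lambda>x. 2 * x) G) (map (\<lambda>x. 2 * x) xs) (map (map_prod (\<lambda>x. 2 * x)
    (\<lambda>x. 2 * x)) es)"
       "listed (relabel (\<lambda>x. 2 * x + 1) H) (map (\<lambda>x. 2 * x + 1) ys) (map (map_prod
         (\<lambda>x. 2 * x + 1) (\<lambda>x. 2 * x + 1)) fs)"
    using assms by (auto intro!: listed_relabel simp del: One_nat_def simp: inj_def)
  moreover have "(2::nat) * x \<noteq> 2 * y + 1" for x y by presburger
  ultimately show ?thesis
    unfolding listed_def disj_union_def Let_def
    by (auto simp del: One_nat_def simp: image_Un)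
qed

lemma listed_join:
  assumes "listed G xs es" "listed H ys fs"
  shows "listed (join G H) (map (\<lambda>x. 2 * x) xs @ map (\<lambda>x. 2 * x + 1) ys)
    (map (map_prod (\<lambda>x. 2 * x) (\<lambda>x. 2 * x)) es @ map (map_prod (\<lambda>x. 2 * x + 1) (\<lambda>x. 2 * x + 1)) fs @
     List.product (map (\<lambda>x. 2 * x) xs) (map (\<lambda>x. 2 * x + 1) ys))"
    (is "listed _ ?vs (?es @ ?fs @ ?gs)")
proof -
  have "listed (disj_union G H) ?vs (?es @ ?fs)"
    using assms by (rule listed_disj_union)
  moreover have "uverts (join G H) = uverts (disj_union G H)"
    by (simp add: join_def disj_union_def Let_def)
  moreover have "uedges (join G H) = uedges (disj_union G H) \<union> (\<lambda>(x, y). {x, y}) ` set ?gs"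
    using assms by (auto simp: join_def disj_union_def Let_def relabel_def listed_def)
  moreover have "(2::nat) * x \<noteq> 2 * y + 1" for x y by presburger
  ultimately show ?thesis
    unfolding listed_def set_append image_Un ball_Un
    by (intro conjI) (simp_all only: Un_assoc, auto simp del: One_nat_def)
qed

lemma listed_complement:
  assumes "listed G xs es"
  shows "listed (complement G) xs
    (filter (\<lambda>(x, y). x \<noteq> y \<and> \<not> listed_adj es x y) (List.product xs xs))"
proof -
  have "uedges (complement G) = (\<lambda>(x, y). {x, y}) `
      {(x, y). x \<in> set xs \<and> y \<in> set xs \<and> x \<noteq> y \<and> {x, y} \<notin> uedges G}"
    by (auto simp: complement_def listedD(2)[OF assms])
  then show ?thesis
    using assms unfolding listedD(3)[OF assms]
    by (auto simp: listed_def complement_def)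
qed

lemma listed_path: "listed (path_graph n) [0..<n] (map (\<lambda>i. (i, Suc i)) [0..<n - 1])"
  by (auto simp: listed_def path_graph_def)

text \<open>The bound on \<open>n\<close> excludes \<open>n = 1\<close>, where
  \<open>Suc 0 mod 1 = 0\<close> produces a loop. For \<open>n = 2\<close> the single edge is listed
  in both orientations.\<close>

lemma listed_cycle:
  assumes "2 \<le> n"
  shows "listed (cycle_graph n) [0..<n] (map (\<lambda>i. (i, Suc i mod n)) [0..<n])"
proof -
  have "uedges (cycle_graph n) = (\<lambda>i. {i, Suc i mod n}) ` {..<n}"
    by (auto simp: cycle_graph_def)
  moreover have "i \<noteq> Suc i mod n" if "i < n" for i
    using that assms by (cases "Suc i = n") auto
  ultimately show ?thesis
    by (auto simp: listed_def cycle_graph_def image_image atLeast0LessThan)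
qed

lemma listed_complete:
  "listed (complete_graph n) [0..<n] (filter (\<lambda>(i, j). i \<noteq> j) (List.product [0..<n] [0..<n]))"
  by (fastforce simp: listed_def complete_graph_def)

lemma listed_complete_bipartite:
  "listed (complete_bipartite m n) [0..<m + n] (List.product [0..<m] [m..<m + n])"
  by (fastforce simp: listed_def complete_bipartite_def)

lemma listed_copies_0: "listed (copies 0 G) [] []"
  by (simp add: listed_def)

lemma listed_four_pan: "listed four_pan [0,1,2,3,4] [(0,1),(1,2),(2,3),(3,0),(0,4)]"
proof -
  have "listed (cycle_graph 4) [0,1,2,3] [(0,1),(1,2),(2,3),(3,0)]"
    using listed_cycle[of 4] by (simp add: upt_rec numeral_2_eq_2[symmetric])
  then show ?thesis
    unfolding listed_def four_pan_def ugraph.select_convs by auto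
qed

lemma listed_X1: "listed X1 [0,1,2,3,4,5] [(0,1),(0,2),(0,4),(0,5),(1,5),(2,5),(2,3)]"
  unfolding listed_def X1_def Let_def ugraph.select_convs by simp

lemma listed_X2: "listed X2 [0,1,2,3,4,5] [(4,5),(0,1),(0,2),(0,4),(0,5),(1,5),(2,5),(2,3)]"
  using listed_X1 unfolding listed_def X2_def Let_def ugraph.select_convs by simp

section \<open>2-switches\<close>

text \<open>The exchange along an alternating 4-cycle p, q, r, s; the diagonals pr and qs are
  unconstrained. Only the four vertices are confined to \<open>V\<close>, while \<open>E\<close> may
  reach beyond it, so that an induction can shrink \<open>V\<close> and keep the edge set
  whole.\<close>

definition two_switch :: "'a set \<Rightarrow> 'a set set \<Rightarrow> 'a set set \<Rightarrow> bool" where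
  "two_switch V E E' \<longleftrightarrow> (\<exists>p q r s. {p, q, r, s} \<subseteq> V \<and> distinct [p, q, r, s] \<and>
     {p, q} \<in> E \<and> {r, s} \<in> E \<and> {q, r} \<notin> E \<and> {p, s} \<notin> E \<and>
     E' = E - {{p, q}, {r, s}} \<union> {{q, r}, {p, s}})"

definition simple_edges :: "'a set set \<Rightarrow> bool" where
  "simple_edges E \<longleftrightarrow> (\<forall>e\<in>E. \<exists>x y. e = {x, y} \<and> x \<noteq> y)"

lemma simple_edgesD: "simple_edges E \<Longrightarrow> e \<in> E \<Longrightarrow> \<exists>x y. e = {x, y} \<and> x \<noteq> y"
  by (simp add: simple_edges_def)

lemma two_switchI:
  assumes "{p, q, r, s} \<subseteq> V" "distinct [p, q, r, s]"
    "{p, q} \<in> E" "{r, s} \<in> E" "{q, r} \<notin> E" "{p, s} \<notin> E"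
  shows "two_switch V E (E - {{p, q}, {r, s}} \<union> {{q, r}, {p, s}})"
  using assms unfolding two_switch_def by blast

text \<open>Only neighbours inside \<open>V\<close> count, so removing a vertex from
  \<open>V\<close> adjusts the degrees without touching \<open>E\<close>.\<close>

definition nbh :: "'a set \<Rightarrow> 'a set set \<Rightarrow> 'a \<Rightarrow> 'a set" where
  "nbh V E x = {y \<in> V. {x, y} \<in> E}"

lemma simple_edges_singleton: "simple_edges E \<Longrightarrow> {x} \<notin> E"
  by (auto simp: simple_edges_def doubleton_eq_iff)

lemma two_switch_sym:
  assumes "two_switch V E E'"
  shows "two_switch V E' E"
proof -
  obtain p q r s where *: "{p, q, r, s} \<subseteq> V" "distinct [p, q, r, s]"
     "{p, q} \<in> E" "{r, s} \<in> E" "{q, r} \<notin> E" "{p, s} \<notin> E"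
     and E': "E' = E - {{p, q}, {r, s}} \<union> {{q, r}, {p, s}}"
    using assms by (auto simp: two_switch_def)
  have "E = E' - {{r, q}, {p, s}} \<union> {{q, p}, {r, s}}"
    using * unfolding E' by (auto simp: insert_commute)
  moreover have "{r, q} \<in> E'" "{p, s} \<in> E'" "{q, p} \<notin> E'" "{r, s} \<notin> E'"
    using * unfolding E' by (auto simp: doubleton_eq_iff)
  ultimately show ?thesis using *(1,2) two_switchI[of r q p s V E'] by (auto simp: insert_commute)
qed

lemma two_switches_sym: "(two_switch V)\<^sup>*\<^sup>* E E' \<Longrightarrow> (two_switch V)\<^sup>*\<^sup>* E' E"
  using two_switch_sym by (metis symp_rtranclp sympD sympI)

lemma two_switch_mono: "V \<subseteq> U \<Longrightarrow> two_switch V E E' \<Longrightarrow> two_switch U E E'"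
  unfolding two_switch_def by blast

lemma two_switch_simple:
  assumes "two_switch V E E'" "simple_edges E"
  shows "simple_edges E'"
  using assms unfolding two_switch_def simple_edges_def by auto

lemma two_switch_outside:
  assumes "two_switch V E E'" "\<not> e \<subseteq> V"
  shows "e \<in> E' \<longleftrightarrow> e \<in> E"
  using assms unfolding two_switch_def by auto

lemma card_exchange:
  assumes "finite A" "a \<in> A" "b \<notin> A"
  shows "card (insert b (A - {a})) = card A"
  using assms by (metis DiffD1 card.remove card_insert_disjoint finite_Diff)

lemma two_switch_degree:
  assumes "two_switch V E E'" "finite V"
  shows "card (nbh V E' x) = card (nbh V E x)"
proof -
  obtain p q r s where *: "{p, q, r, s} \<subseteq> V" "distinct [p, q, r, s]"
     "{p, q} \<in> E" "{r, s} \<in> E" "{q, r} \<notin> E" "{p, s} \<notin> E"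
     and E': "E' = E - {{p, q}, {r, s}} \<union> {{q, r}, {p, s}}"
    using assms by (auto simp: two_switch_def)
  have fin: "finite (nbh V E y)" for y using assms(2) by (simp add: nbh_def)
  have sym: "{q, p} \<in> E" "{s, r} \<in> E" "{r, q} \<notin> E" "{s, p} \<notin> E"
    using * by (auto simp: insert_commute)
  consider "x = p" | "x = q" | "x = r" | "x = s" | "x \<notin> {p, q, r, s}" by blast
  then show ?thesis
  proof cases
    case 1
    then have "nbh V E' x = insert s (nbh V E x - {q})"
      using * by (auto simp: nbh_def E' doubleton_eq_iff)
    moreover have "q \<in> nbh V E x" "s \<notin> nbh V E x" using 1 * sym by (auto simp: nbh_def)
    ultimately show ?thesis by (metis card_exchange[OF fin])
  next
    case 2
    then have "nbh V E' x = insert r (nbh V E x - {p})"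
      using * by (auto simp: nbh_def E' doubleton_eq_iff)
    moreover have "p \<in> nbh V E x" "r \<notin> nbh V E x" using 2 * sym by (auto simp: nbh_def)
    ultimately show ?thesis by (metis card_exchange[OF fin])
  next
    case 3
    then have "nbh V E' x = insert q (nbh V E x - {s})"
      using * by (auto simp: nbh_def E' doubleton_eq_iff)
    moreover have "s \<in> nbh V E x" "q \<notin> nbh V E x" using 3 * sym by (auto simp: nbh_def)
    ultimately show ?thesis by (metis card_exchange[OF fin])
  next
    case 4
    then have "nbh V E' x = insert p (nbh V E x - {r})"
      using * by (auto simp: nbh_def E' doubleton_eq_iff)
    moreover have "r \<in> nbh V E x" "p \<notin> nbh V E x" using 4 * sym by (auto simp: nbh_def)
    ultimately show ?thesis by (metis card_exchange[OF fin])
  next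
    case 5
    then have "nbh V E' x = nbh V E x"
      by (auto simp: nbh_def E' doubleton_eq_iff)
    then show ?thesis by simp
  qed
qed

lemma two_switches_preserve:
  assumes "(two_switch V)\<^sup>*\<^sup>* E E'" "finite V" "simple_edges E"
  shows "simple_edges E' \<and> (\<forall>x. card (nbh V E' x) = card (nbh V E x)) \<and>
    (\<forall>e. \<not> e \<subseteq> V \<longrightarrow> (e \<in> E' \<longleftrightarrow> e \<in> E))"
  using assms(1)
proof (induction rule: rtranclp_induct)
  case base
  then show ?case using assms(3) by simp
next
  case (step E' E'')
  then show ?case
    using two_switch_simple two_switch_outside two_switch_degree[OF _ assms(2)] by metis
qed

text \<open>As \<open>v\<close> is a neighbour of \<open>x\<close> but not of \<open>y\<close>, and
  \<open>y\<close> has at least the degree of \<open>x\<close>, some neighbour \<open>z\<close> of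
  \<open>y\<close> is neither \<open>x\<close> nor a neighbour of \<open>x\<close>. Replacing the
  edges vx, yz by vy, xz gives \<open>v\<close> the neighbour \<open>y\<close> in place of
  \<open>x\<close>.\<close>

lemma exchange_neighbour:
  assumes V: "finite V" "v \<in> V" "x \<in> V" "y \<in> V" and E: "simple_edges E"
    and x: "{v, x} \<in> E" and y: "{v, y} \<notin> E" "y \<noteq> v"
    and deg: "card (nbh V E x) \<le> card (nbh V E y)"
  obtains E' where "two_switch V E E'" "nbh V E' v = insert y (nbh V E v - {x})"
proof -
  have nv: "v \<in> nbh V E x" "v \<notin> nbh V E y"
    using V x y by (auto simp: nbh_def insert_commute)
  have fin: "finite (nbh V E u)" for u using V(1) by (simp add: nbh_def)
  \<comment> \<open>Adjacency of \<open>x\<close> and \<open>y\<close> affects both neighbourhoods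
    alike, so discarding \<open>y\<close> from one and \<open>x\<close> from the other keeps the
    inequality of sizes. Discarding also \<open>v\<close>, a neighbour of \<open>x\<close> alone,
    makes it strict and yields \<open>z\<close>.\<close>
  have "y \<in> nbh V E x \<longleftrightarrow> x \<in> nbh V E y" using V by (auto simp: nbh_def insert_commute)
  then have "card (nbh V E x - {y}) \<le> card (nbh V E y - {x})"
    using deg fin by (auto simp: card_Diff_singleton_if)
  moreover have "card (nbh V E x - {y} - {v}) < card (nbh V E x - {y})"
    using nv(1) y(2) fin by (intro card_Diff1_less) auto
  ultimately have "\<not> nbh V E y - {x} \<subseteq> nbh V E x - {y} - {v}"
    using fin[of x] card_mono[of "nbh V E x - {y} - {v}" "nbh V E y - {x}"] by auto
  then obtain z where z: "z \<in> nbh V E y" "z \<noteq> x" "z \<notin> nbh V E x - {y} - {v}" by blast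
  have zy: "z \<noteq> y" using z(1) simple_edges_singleton[OF E] by (auto simp: nbh_def)
  have zv: "z \<noteq> v" using z(1) nv by auto
  have z': "z \<in> V" "{y, z} \<in> E" "{x, z} \<notin> E" using z zy zv by (auto simp: nbh_def)
  have xv: "x \<noteq> v" using x simple_edges_singleton[OF E] by auto
  have xy: "x \<noteq> y" using x y by auto
  let ?E = "E - {{x, v}, {y, z}} \<union> {{v, y}, {x, z}}"
  have "{x, v} \<in> E" using x by (simp add: insert_commute)
  then have "two_switch V E ?E"
    using V z' z(2) zy zv xv xy y by (intro two_switchI) simp_all
  moreover have "nbh V ?E v = insert y (nbh V E v - {x})"
    using V zv xv y(2) by (auto simp: nbh_def doubleton_eq_iff)
  ultimately show thesis using that by blast
qed

text \<open>If \<open>x\<close> is a neighbour of \<open>v\<close> in \<open>E\<close> only and \<open>y\<close> in \<open>F\<close> only, then one of \<open>x\<close>, \<open>y\<close> has at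
  least the degree of the other, so \<open>exchange_neighbour\<close> applies to \<open>E\<close> or to \<open>F\<close>.\<close>

lemma align_neighbourhoods:
  assumes "finite V" "v \<in> V" "simple_edges E" "simple_edges F"
    and "\<forall>x\<in>V. card (nbh V E x) = card (nbh V F x)"
  shows "\<exists>E' F'. (two_switch V)\<^sup>*\<^sup>* E E' \<and> (two_switch V)\<^sup>*\<^sup>* F F' \<and> nbh V E' v = nbh V F' v"
  using assms(3-)
\<comment> \<open>The measure counts the neighbours of \<open>v\<close> in \<open>E\<close> only.
  Exchanging \<open>x\<close> for \<open>y\<close> in \<open>E\<close> and exchanging
  \<open>y\<close> for \<open>x\<close> in \<open>F\<close> both remove exactly \<open>x\<close>
  from this difference.\<close>
proof (induction "card (nbh V E v - nbh V F v)" arbitrary: E F rule: less_induct)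
  case less
  note E = less.prems(1) and F = less.prems(2) and deg = less.prems(3)
  have fin: "finite (nbh V D u)" for D u using assms(1) by (simp add: nbh_def)
  show ?case
  proof (cases "nbh V E v = nbh V F v")
    case True
    then show ?thesis by blast
  next
    case False
    \<comment> \<open>The two neighbourhoods are finite sets of equal size, so if they differ then
      neither contains the other.\<close>
    then have "\<not> nbh V E v \<subseteq> nbh V F v" "\<not> nbh V F v \<subseteq> nbh V E v"
      using deg assms(2) fin by (metis card_subset_eq)+
    then obtain x y where x: "x \<in> nbh V E v" "x \<notin> nbh V F v" and y: "y \<in> nbh V F v" "y \<notin> nbh V E v"
      by blast
    have xV: "x \<in> V" "{v, x} \<in> E" "{v, x} \<notin> F" and yV: "y \<in> V" "{v, y} \<in> F" "{v, y} \<notin> E"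
      using x y by (auto simp: nbh_def)
    have "x \<noteq> v" "y \<noteq> v" using xV yV simple_edges_singleton E F by force+
    have dec: "card (A - B) < card (nbh V E v - nbh V F v)"
      if "A - B = nbh V E v - nbh V F v - {x}" for A B
      using x fin unfolding that by (intro card_Diff1_less) auto
    show ?thesis
    proof (cases "card (nbh V E x) \<le> card (nbh V E y)")
      case True
      obtain D where D: "two_switch V E D" "nbh V D v = insert y (nbh V E v - {x})"
        by (rule exchange_neighbour[OF assms(1,2) xV(1) yV(1) E xV(2) yV(3) \<open>y \<noteq> v\<close> True])
      have "nbh V D v - nbh V F v = nbh V E v - nbh V F v - {x}" using D(2) y by auto
      then have "\<exists>E' F'. (two_switch V)\<^sup>*\<^sup>* D E' \<and> (two_switch V)\<^sup>*\<^sup>* F F' \<and>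
        nbh V E' v = nbh V F' v"
        using deg two_switch_simple[OF D(1) E] F two_switch_degree[OF D(1) assms(1)]
        by (intro less.hyps dec) auto
      then show ?thesis using D(1) by (meson converse_rtranclp_into_rtranclp)
    next
      case False
      then have le: "card (nbh V F y) \<le> card (nbh V F x)" using deg xV yV by simp
      obtain D where D: "two_switch V F D" "nbh V D v = insert x (nbh V F v - {y})"
        by (rule exchange_neighbour[OF assms(1,2) yV(1) xV(1) F yV(2) xV(3) \<open>x \<noteq> v\<close> le])
      have "nbh V E v - nbh V D v = nbh V E v - nbh V F v - {x}" using D(2) y by auto
      then have "\<exists>E' F'. (two_switch V)\<^sup>*\<^sup>* E E' \<and> (two_switch V)\<^sup>*\<^sup>* D F' \<and>
        nbh V E' v = nbh V F' v"
        using deg two_switch_simple[OF D(1) F] E two_switch_degree[OF D(1) assms(1)]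
        by (intro less.hyps dec) auto
      then show ?thesis using D(1) by (meson converse_rtranclp_into_rtranclp)
    qed
  qed
qed

text \<open>Switches applied to both sides make the neighbourhoods of one vertex \<open>v\<close>
  agree. After that every other vertex loses \<open>v\<close> on both sides or on neither, so
  degrees within the smaller set still agree and the induction applies. Reversibility of switches
  turns the path from \<open>F\<close> to \<open>F'\<close> around.\<close>

lemma two_switch_connected:
  assumes "finite V" "simple_edges E" "simple_edges F"
    and "\<forall>x\<in>V. card (nbh V E x) = card (nbh V F x)"
    and "\<forall>e. \<not> e \<subseteq> V \<longrightarrow> (e \<in> E \<longleftrightarrow> e \<in> F)"
  shows "(two_switch V)\<^sup>*\<^sup>* E F"
  using assms
proof (induction V arbitrary: E F rule: finite_induct)
  case empty
  \<comment> \<open>With no vertices left, agreement off \<open>V\<close> covers every nonempty set,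
    and the empty set is not an edge.\<close>
  then have "e \<in> E \<longleftrightarrow> e \<in> F" for e by (cases "e = {}") (auto simp: simple_edges_def)
  then have "E = F" by blast
  then show ?case by simp
next
  case (insert v V)
  let ?U = "insert v V"
  obtain E' F' where E': "(two_switch ?U)\<^sup>*\<^sup>* E E'" and F': "(two_switch ?U)\<^sup>*\<^sup>* F F'"
    and v: "nbh ?U E' v = nbh ?U F' v"
    using align_neighbourhoods[of ?U v E F] insert by auto
  have PE: "simple_edges E'" "card (nbh ?U E' x) = card (nbh ?U E x)"
    "\<not> e \<subseteq> ?U \<Longrightarrow> e \<in> E' \<longleftrightarrow> e \<in> E" for x e
    using two_switches_preserve[OF E'] insert by auto
  have PF: "simple_edges F'" "card (nbh ?U F' x) = card (nbh ?U F x)"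
    "\<not> e \<subseteq> ?U \<Longrightarrow> e \<in> F' \<longleftrightarrow> e \<in> F" for x e
    using two_switches_preserve[OF F'] insert by auto
  have v': "{v, x} \<in> E' \<longleftrightarrow> {v, x} \<in> F'" if "x \<in> ?U" for x
    using v that unfolding nbh_def by blast
  have "(two_switch V)\<^sup>*\<^sup>* E' F'"
  proof (rule insert.IH[OF PE(1) PF(1)])
    have drop: "nbh V D x = nbh ?U D x - {v}" for D x
      using insert.hyps by (auto simp: nbh_def)
    show "\<forall>x\<in>V. card (nbh V E' x) = card (nbh V F' x)"
    proof
      fix x assume x: "x \<in> V"
      then have "v \<in> nbh ?U E' x \<longleftrightarrow> v \<in> nbh ?U F' x"
        using v'[of x] by (auto simp: nbh_def insert_commute)
      then show "card (nbh V E' x) = card (nbh V F' x)"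
        using PE(2) PF(2) insert.prems(3) x insert.hyps(1) unfolding drop
        by (auto simp: card_Diff_singleton_if)
    qed
    show "\<forall>e. \<not> e \<subseteq> V \<longrightarrow> (e \<in> E' \<longleftrightarrow> e \<in> F')"
    proof (intro allI impI)
      fix e assume e: "\<not> e \<subseteq> V"
      show "e \<in> E' \<longleftrightarrow> e \<in> F'"
      proof (cases "e \<subseteq> ?U")
        case False
        then show ?thesis using PE(3) PF(3) insert.prems(4) by blast
      next
        case True
        \<comment> \<open>The pair lies within \<open>?U\<close> but not within \<open>V\<close>, so
          it contains \<open>v\<close>, and the aligned neighbourhoods of \<open>v\<close> decide
          whether it is an edge.\<close>
        then have "v \<in> e" using e by blast
        have "\<exists>x\<in>?U. e = {v, x}" if e': "e \<in> E' \<or> e \<in> F'"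
        proof -
          obtain a b where "e = {a, b}"
            using e' simple_edgesD[OF PE(1), of e] simple_edgesD[OF PF(1), of e] by blast
          then show ?thesis using True \<open>v \<in> e\<close> by auto
        qed
        then show ?thesis using v' by metis
      qed
    qed
  qed
  then have "(two_switch ?U)\<^sup>*\<^sup>* E' F'"
    using two_switch_mono[of V ?U] by (metis mono_rtranclp subset_insertI)
  then show ?case using E' two_switches_sym[OF F'] by (meson rtranclp_trans)
qed

section \<open>Configurations and the effect of 2-switches\<close>

lemma contains_config_iso:
  assumes "graph_iso G H" "is_configuration C" "contains_config G C"
  shows "contains_config H C"
proof -
  obtain f where f: "bij_betw f (uverts G) (uverts H)"
    "\<forall>x\<in>uverts G. \<forall>y\<in>uverts G. {x, y} \<in> uedges G \<longleftrightarrow> {f x, f y} \<in> uedges H"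
    using assms(1) by (auto simp: graph_iso_def)
  obtain g where g: "inj_on g (cverts C)" "g ` cverts C \<subseteq> uverts G"
      "\<forall>e\<in>cedges C. g ` e \<in> uedges G" "\<forall>e\<in>cnonedges C. g ` e \<notin> uedges G"
    using assms(3) by (auto simp: contains_config_def)
  have *: "(f \<circ> g) ` e \<in> uedges H \<longleftrightarrow> g ` e \<in> uedges G" if "e \<in> cedges C \<union> cnonedges C" for e
  proof -
    have "e \<in> {{x, y} | x y. x \<in> cverts C \<and> y \<in> cverts C \<and> x \<noteq> y}"
      using that assms(2) unfolding is_configuration_def fin_graph_def by auto
    then obtain x y where "e = {x, y}" "x \<in> cverts C" "y \<in> cverts C" by blast
    then show ?thesis using f(2) g(2) by auto
  qed
  have "inj_on (f \<circ> g) (cverts C)"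
    using f(1) g(1,2) by (auto simp: bij_betw_def intro: comp_inj_on inj_on_subset)
  moreover have "(f \<circ> g) ` cverts C \<subseteq> uverts H"
    using f(1) g(2) by (auto simp: bij_betw_def)
  ultimately show ?thesis
    unfolding contains_config_def using * g(3,4) by (intro exI[of _ "f \<circ> g"]) auto
qed

text \<open>Replaces the embedding of numbered vertices by named vertices. A choice of vertices
  becomes a function through \<open>nth\<close> of their list; its values at other numbers are
  irrelevant.\<close>

lemma contains_config_simps:
  "contains_config G config_a \<longleftrightarrow> (\<exists>p q r s w. {p, q, r, s, w} \<subseteq> uverts G \<and> distinct [p, q, r, s, w] \<and>
     {p, q} \<in> uedges G \<and> {r, s} \<in> uedges G \<and> {q, w} \<in> uedges G \<and> {r, w} \<in> uedges G \<and>
     {q, r} \<notin> uedges G \<and> {p, s} \<notin> uedges G \<and> {p, w} \<notin> uedges G \<and> {s, w} \<notin> uedges G)" (is ?a)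
  "contains_config G config_b \<longleftrightarrow> (\<exists>p q r s w. {p, q, r, s, w} \<subseteq> uverts G \<and> distinct [p, q, r, s, w] \<and>
     {p, q} \<in> uedges G \<and> {r, s} \<in> uedges G \<and> {p, w} \<in> uedges G \<and> {q, w} \<in> uedges G \<and>
     {q, r} \<notin> uedges G \<and> {p, s} \<notin> uedges G \<and> {r, w} \<notin> uedges G \<and> {s, w} \<notin> uedges G)" (is ?b)
  "contains_config G config_c \<longleftrightarrow> (\<exists>p q r s y z. {p, q, r, s, y, z} \<subseteq> uverts G \<and>
    distinct [p, q, r, s, y, z] \<and>
     {p, q} \<in> uedges G \<and> {r, s} \<in> uedges G \<and> {p, z} \<in> uedges G \<and> {q, y} \<in> uedges G \<and>
     {q, r} \<notin> uedges G \<and> {p, s} \<notin> uedges G \<and> {r, z} \<notin> uedges G \<and> {s, y} \<notin> uedges G)" (is ?c)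
  "contains_config G config_d \<longleftrightarrow> (\<exists>p q r s y z. {p, q, r, s, y, z} \<subseteq> uverts G \<and>
    distinct [p, q, r, s, y, z] \<and>
     {p, q} \<in> uedges G \<and> {r, s} \<in> uedges G \<and> {r, y} \<in> uedges G \<and> {q, z} \<in> uedges G \<and>
     {q, r} \<notin> uedges G \<and> {p, s} \<notin> uedges G \<and> {p, y} \<notin> uedges G \<and> {s, z} \<notin> uedges G)" (is ?d)
proof -
  have ex5: "(\<exists>p q r s w. P p q r s w) \<longleftrightarrow> (\<exists>f::nat \<Rightarrow> 'a. P (f 0) (f 1) (f 2) (f 3) (f 4))" for P
  proof
    assume "\<exists>p q r s w. P p q r s w"
    then obtain p q r s w where "P p q r s w" by blast
    then show "\<exists>f::nat \<Rightarrow> 'a. P (f 0) (f 1) (f 2) (f 3) (f 4)"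
      by (intro exI[of _ "nth [p, q, r, s, w]"]) simp
  qed blast
  have ex6: "(\<exists>p q r s y z. P p q r s y z) \<longleftrightarrow>
    (\<exists>f::nat \<Rightarrow> 'a. P (f 0) (f 1) (f 2) (f 3) (f 4) (f 5))" for P
  proof
    assume "\<exists>p q r s y z. P p q r s y z"
    then obtain p q r s y z where "P p q r s y z" by blast
    then show "\<exists>f::nat \<Rightarrow> 'a. P (f 0) (f 1) (f 2) (f 3) (f 4) (f 5)"
      by (intro exI[of _ "nth [p, q, r, s, y, z]"]) simp
  qed blast
  show ?a ?b unfolding ex5 contains_config_def config_a_def config_b_def Let_def
    configuration.select_convs
    by (rule ex_cong1; auto simp: inj_on_def)+
  show ?c ?d unfolding ex6 contains_config_def config_c_def config_d_def Let_def
    configuration.select_convs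
    by (rule ex_cong1; auto simp: inj_on_def)+
qed

text \<open>Let \<open>A\<close>, \<open>B\<close>, \<open>C\<close>, \<open>D\<close> be the sets of vertices \<open>w\<close> outside \<open>p\<close>, \<open>q\<close>, \<open>r\<close>, \<open>s\<close> that are
  adjacent to \<open>p\<close> but not \<open>r\<close>, to \<open>r\<close> but not \<open>p\<close>, to \<open>q\<close> but not \<open>s\<close>, and to \<open>s\<close> but not \<open>q\<close>.
  Configurations (b), (c) forbid that \<open>A\<close>, \<open>C\<close> or \<open>B\<close>, \<open>D\<close> are both nonempty, and (a), (d) forbid it
  for \<open>B\<close>, \<open>C\<close> and for \<open>A\<close>, \<open>D\<close>. Hence \<open>A\<close> and \<open>B\<close> are empty or \<open>C\<close> and \<open>D\<close> are, and the 2-switch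
  is undone by exchanging \<open>p\<close> with \<open>r\<close> or \<open>q\<close> with \<open>s\<close>.\<close>

lemma two_switch_iso:
  assumes G: "fin_graph G" and sw: "two_switch (uverts G) (uedges G) E'"
    and free: "\<not> contains_config G config_a" "\<not> contains_config G config_b"
      "\<not> contains_config G config_c" "\<not> contains_config G config_d"
  shows "graph_iso G \<lparr>uverts = uverts G, uedges = E'\<rparr>"
proof -
  let ?V = "uverts G" and ?E = "uedges G"
  obtain p q r s where V: "p \<in> ?V" "q \<in> ?V" "r \<in> ?V" "s \<in> ?V"
     and dist: "p \<noteq> q" "p \<noteq> r" "p \<noteq> s" "q \<noteq> r" "q \<noteq> s" "r \<noteq> s"
     and E: "{p, q} \<in> ?E" "{r, s} \<in> ?E" "{q, r} \<notin> ?E" "{p, s} \<notin> ?E"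
     and E': "E' = ?E - {{p, q}, {r, s}} \<union> {{q, r}, {p, s}}"
    using sw by (auto simp: two_switch_def)
  have sing: "{x} \<notin> ?E" for x using G by (auto simp: fin_graph_def doubleton_eq_iff)
  have swap: "graph_iso G \<lparr>uverts = ?V, uedges = E'\<rparr>"
    if twins: "\<And>w. w \<in> ?V - {a, b, c, d} \<Longrightarrow> {a, w} \<in> ?E \<longleftrightarrow> {c, w} \<in> ?E"
      and "a \<in> ?V" "b \<in> ?V" "c \<in> ?V" "d \<in> ?V" "distinct [a, b, c, d]"
      and "{a, b} \<in> ?E" "{c, d} \<in> ?E" "{b, c} \<notin> ?E" "{a, d} \<notin> ?E"
      and E': "E' = ?E - {{a, b}, {c, d}} \<union> {{b, c}, {a, d}}" for a b c d
  proof -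
    let ?f = "id(a := c, c := a)"
    have "bij_betw ?f ?V ?V"
      using that by (intro bij_betw_byWitness[where f' = ?f]) auto
    moreover have "{x, y} \<in> ?E \<longleftrightarrow> {?f x, ?f y} \<in> E'" if xy: "x \<in> ?V" "y \<in> ?V" for x y
    proof -
      have mem: "{u, v} \<in> E' \<longleftrightarrow> {u, v} = {b, c} \<or> {u, v} = {a, d} \<or>
          {u, v} \<in> ?E \<and> {u, v} \<noteq> {a, b} \<and> {u, v} \<noteq> {c, d}" for u v
        unfolding E' by blast
      \<comment> \<open>Off the cycle this is \<open>twins\<close>. On the cycle it holds because
        the switch gives \<open>a\<close> the neighbour \<open>d\<close> for \<open>b\<close>, and
        gives \<open>c\<close> the neighbour \<open>b\<close> for \<open>d\<close>.\<close>
      have *: "{a, w} \<in> ?E \<longleftrightarrow> {c, ?f w} \<in> E'" "{c, w} \<in> ?E \<longleftrightarrow> {a, ?f w} \<in> E'" if "w \<in> ?V" for w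
        using that \<open>distinct [a, b, c, d]\<close> sing twins[of w]
          \<open>{a, b} \<in> ?E\<close> \<open>{c, d} \<in> ?E\<close> \<open>{b, c} \<notin> ?E\<close> \<open>{a, d} \<notin> ?E\<close>
        unfolding mem
        by (cases "w \<in> {a, b, c, d}"; auto simp: doubleton_eq_iff insert_commute)+
      \<comment> \<open>All four pairs altered by the switch contain \<open>a\<close> or
        \<open>c\<close>, so a pair avoiding both is untouched by the switch and by the
        transposition.\<close>
      consider "x \<in> {a, c}" | "y \<in> {a, c}" | "x \<notin> {a, c}" "y \<notin> {a, c}" by blast
      then show ?thesis
      proof cases
        case 1
        then show ?thesis using *[OF xy(2)] by auto
      next
        case 2
        have "{x, y} = {y, x}" "{?f x, ?f y} = {?f y, ?f x}" by blast+
        then show ?thesis using 2 *[OF xy(1)] by (elim insertE emptyE) simp_all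
      next
        case 3
        then show ?thesis unfolding mem by (auto simp: doubleton_eq_iff)
      qed
    qed
    ultimately show ?thesis unfolding graph_iso_def by auto
  qed
  have sym: "{q, p} \<in> ?E" "{s, r} \<in> ?E" "{r, q} \<notin> ?E" "{s, p} \<notin> ?E"
    using E by (auto simp: insert_commute)
  have ex5: "P a b c d e \<Longrightarrow> \<exists>p q r s w. P p q r s w" for P and a b c d e :: 'a by blast
  have ex6: "P a b c d e f \<Longrightarrow> \<exists>p q r s y z. P p q r s y z" for P and a b c d e f :: 'a by blast
  define W where "W = ?V - {p, q, r, s}"
  \<comment> \<open>Stated for any labelling of the cycle: the labelling p, q, r, s and its half
    turn r, s, p, q cover two of the four combinations. The witnesses may coincide, which gives (b),
    or differ, which gives (c).\<close>
  have c: False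
    if abcd: "{a, b, c, d} = {p, q, r, s}" "{a, b} \<in> ?E" "{c, d} \<in> ?E" "{b, c} \<notin> ?E" "{a, d} \<notin> ?E"
      "distinct [a, b, c, d]"
    and z: "z \<in> W" "{a, z} \<in> ?E" "{c, z} \<notin> ?E" and y: "y \<in> W" "{b, y} \<in> ?E" "{d, y} \<notin> ?E"
    for a b c d y z
  proof -
    have "{a, b, c, d} \<subseteq> ?V" "z \<notin> {a, b, c, d}" "y \<notin> {a, b, c, d}" "y \<in> ?V" "z \<in> ?V"
      using abcd(1) V y(1) z(1) by (auto simp: W_def)
    note facts = this abcd(2-) y(2-) z(2-)
    have "contains_config G config_b" if "y = z" unfolding contains_config_simps
      by (rule ex5[of _ a b c d z]) (use facts that in auto)
    moreover have "contains_config G config_c" if "y \<noteq> z" unfolding contains_config_simps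
      by (rule ex6[of _ a b c d y z]) (use facts that in auto)
    ultimately show False using free by blast
  qed
  have d: False
    if abcd: "{a, b, c, d} = {p, q, r, s}" "{a, b} \<in> ?E" "{c, d} \<in> ?E" "{b, c} \<notin> ?E" "{a, d} \<notin> ?E"
      "distinct [a, b, c, d]"
    and y: "y \<in> W" "{c, y} \<in> ?E" "{a, y} \<notin> ?E" and z: "z \<in> W" "{b, z} \<in> ?E" "{d, z} \<notin> ?E"
    for a b c d y z
  proof -
    have "{a, b, c, d} \<subseteq> ?V" "z \<notin> {a, b, c, d}" "y \<notin> {a, b, c, d}" "y \<in> ?V" "z \<in> ?V"
      using abcd(1) V y(1) z(1) by (auto simp: W_def)
    note facts = this abcd(2-) y(2-) z(2-)
    have "contains_config G config_a" if "y = z" unfolding contains_config_simps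
      by (rule ex5[of _ a b c d y]) (use facts that in auto)
    moreover have "contains_config G config_d" if "y \<noteq> z" unfolding contains_config_simps
      by (rule ex6[of _ a b c d y z]) (use facts that in auto)
    ultimately show False using free by blast
  qed
  have rs: "{r, s, p, q} = {p, q, r, s}" by auto
  have ac: "\<not> (z \<in> W \<and> {p, z} \<in> ?E \<and> {r, z} \<notin> ?E \<and> y \<in> W \<and> {q, y} \<in> ?E \<and> {s, y} \<notin> ?E)" for y z
    using c[of p q r s z y] dist E by auto
  have bd: "\<not> (z \<in> W \<and> {r, z} \<in> ?E \<and> {p, z} \<notin> ?E \<and> y \<in> W \<and> {s, y} \<in> ?E \<and> {q, y} \<notin> ?E)" for y z
    using c[OF rs, of z y] dist E sym by auto
  have bc: "\<not> (y \<in> W \<and> {r, y} \<in> ?E \<and> {p, y} \<notin> ?E \<and> z \<in> W \<and> {q, z} \<in> ?E \<and> {s, z} \<notin> ?E)" for y z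
    using d[of p q r s y z] dist E by auto
  have ad: "\<not> (y \<in> W \<and> {p, y} \<in> ?E \<and> {r, y} \<notin> ?E \<and> z \<in> W \<and> {s, z} \<in> ?E \<and> {q, z} \<notin> ?E)" for y z
    using d[OF rs, of y z] dist E sym by auto
  have "(\<forall>w\<in>W. {p, w} \<in> ?E \<longleftrightarrow> {r, w} \<in> ?E) \<or> (\<forall>w\<in>W. {q, w} \<in> ?E \<longleftrightarrow> {s, w} \<in> ?E)"
    using ac bd bc ad by blast
  then show ?thesis
  proof
    assume "\<forall>w\<in>W. {p, w} \<in> ?E \<longleftrightarrow> {r, w} \<in> ?E"
    then show ?thesis
      using V dist E E' by (intro swap[of p q r s]) (auto simp: W_def)
  next
    assume "\<forall>w\<in>W. {q, w} \<in> ?E \<longleftrightarrow> {s, w} \<in> ?E"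
    \<comment> \<open>Reading the same alternating cycle as q, p, s, r puts \<open>q\<close> and
      \<open>s\<close> in the positions that \<open>swap\<close> transposes.\<close>
    then show ?thesis
      using V dist E sym by (intro swap[of q p s r]) (auto simp: W_def E' insert_commute)
  qed
qed

text \<open>Used to match the vertices of two graphs by degree. Each element of \<open>A\<close> is
  paired with some element of \<open>B\<close> of equal value, and both are removed.\<close>

lemma bij_betw_image_mset:
  assumes "finite A" "finite B" "image_mset f (mset_set A) = image_mset g (mset_set B)"
  shows "\<exists>h. bij_betw h A B \<and> (\<forall>x\<in>A. g (h x) = f x)"
  using assms
proof (induction A arbitrary: B rule: finite_induct)
  case empty
  then have "B = {}" by (simp add: mset_set_empty_iff)
  then show ?case by (auto simp: bij_betw_def)
next
  case (insert a A)
  have "f a \<in># image_mset g (mset_set B)" using insert by (simp flip: insert.prems(2))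
  then obtain b where b: "b \<in> B" "g b = f a" using insert.prems(1) by auto
  have "mset_set B = add_mset b (mset_set (B - {b}))"
    using b insert.prems(1) by (simp add: mset_set.remove)
  then have "image_mset f (mset_set A) = image_mset g (mset_set (B - {b}))"
    using insert b by simp
  then obtain h where h: "bij_betw h A (B - {b})" "\<forall>x\<in>A. g (h x) = f x"
    using insert.IH[of "B - {b}"] insert.prems(1) by auto
  have "bij_betw (h(a := b)) (insert a A) (insert b (B - {b}))"
    using h(1) insert.hyps(2) by (auto simp: bij_betw_def inj_on_def)
  moreover have "insert b (B - {b}) = B" using b(1) by blast
  moreover have "\<forall>x\<in>insert a A. g ((h(a := b)) x) = f x" using h(2) b insert.hyps(2) by auto
  ultimately show ?case by metis
qed

text \<open>Each intermediate graph is isomorphic to \<open>G\<close>, hence again free of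
  configurations, so the argument for one switch can be repeated.\<close>

lemma config_free_two_switches:
  assumes "(two_switch (uverts G))\<^sup>*\<^sup>* (uedges G) E'" "fin_graph G"
    and free: "\<not> contains_config G config_a" "\<not> contains_config G config_b"
      "\<not> contains_config G config_c" "\<not> contains_config G config_d"
  shows "fin_graph \<lparr>uverts = uverts G, uedges = E'\<rparr> \<and> graph_iso G \<lparr>uverts = uverts G, uedges = E'\<rparr>"
  using assms(1)
proof (induction rule: rtranclp_induct)
  case base
  have "graph_iso G G" unfolding graph_iso_def by (intro exI[of _ id]) auto
  moreover have eq: "\<lparr>uverts = uverts G, uedges = uedges G\<rparr> = G" by (cases G) simp
  ultimately show ?case unfolding eq using assms(2) by blast
next
  case (step E E')
  let ?H = "\<lparr>uverts = uverts G, uedges = E\<rparr>" and ?H' = "\<lparr>uverts = uverts G, uedges = E'\<rparr>"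
  have sw: "two_switch (uverts ?H) (uedges ?H) E'" using step.hyps by simp
  have H: "fin_graph ?H" "graph_iso G ?H" using step.IH by auto
  have "graph_iso ?H \<lparr>uverts = uverts ?H, uedges = E'\<rparr>"
    using free contains_config_iso[OF graph_iso_sym[OF H(2)]] is_configuration_abcd
    by (intro two_switch_iso[OF H(1) sw]) auto
  then have "graph_iso G ?H'" using graph_iso_trans[OF H(2)] by simp
  moreover have "fin_graph ?H'"
    using sw H(1) by (auto simp: two_switch_def fin_graph_def)
  ultimately show ?case by simp
qed

lemma fin_graph_simple: "fin_graph G \<Longrightarrow> simple_edges (uedges G)"
  unfolding fin_graph_def simple_edges_def by blast

text \<open>A competitor is first relabelled by a degree-preserving bijection onto the vertices of
  \<open>G\<close>. The two graphs then have equal degrees vertex by vertex, and switches connect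
  them.\<close>

lemma config_free_unigraph:
  assumes G: "fin_graph G"
    and free: "\<not> contains_config G config_a" "\<not> contains_config G config_b"
      "\<not> contains_config G config_c" "\<not> contains_config G config_d"
  shows "unigraph G"
  unfolding unigraph_def
proof (intro conjI allI impI G)
  fix H :: "nat ugraph"
  assume "fin_graph H \<and> degree_seq H = degree_seq G"
  then have H: "fin_graph H" and deg: "degree_seq H = degree_seq G" by auto
  have fin: "finite (uverts H)" "finite (uverts G)" using G H by (auto simp: fin_graph_def)
  have "image_mset (vdegree H) (mset_set (uverts H)) = image_mset (vdegree G) (mset_set (uverts G))"
    using deg unfolding degree_seq_def rev_is_rev_conv by (metis mset_sorted_list_of_multiset)
  then obtain h where h: "bij_betw h (uverts H) (uverts G)"
    "\<forall>x\<in>uverts H. vdegree G (h x) = vdegree H x"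
    using bij_betw_image_mset[OF fin] by blast
  have inj: "inj_on h (uverts H)" using h(1) by (simp add: bij_betw_def)
  let ?H = "relabel h H"
  have V: "uverts ?H = uverts G" using h(1) by (simp add: relabel_def bij_betw_def)
  have H': "fin_graph ?H" by (rule fin_graph_relabel[OF H inj])
  have "(two_switch (uverts G))\<^sup>*\<^sup>* (uedges G) (uedges ?H)"
  proof (rule two_switch_connected[OF fin(2) fin_graph_simple[OF G] fin_graph_simple[OF H']])
    show "\<forall>x\<in>uverts G. card (nbh (uverts G) (uedges G) x) = card (nbh (uverts G) (uedges ?H) x)"
    proof
      fix y assume "y \<in> uverts G"
      then obtain x where "x \<in> uverts H" "y = h x" using h(1) by (auto simp: bij_betw_def)
      then show "card (nbh (uverts G) (uedges G) y) = card (nbh (uverts G) (uedges ?H) y)"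
        using h(2) vdegree_relabel[OF H inj, of x] V by (simp add: vdegree_def nbh_def)
    qed
    show "\<forall>e. \<not> e \<subseteq> uverts G \<longrightarrow> (e \<in> uedges G) = (e \<in> uedges ?H)"
      using G H' V unfolding fin_graph_def by auto
  qed
  then have "graph_iso G \<lparr>uverts = uverts G, uedges = uedges ?H\<rparr>"
    using config_free_two_switches G free by blast
  moreover have eq: "\<lparr>uverts = uverts G, uedges = uedges ?H\<rparr> = ?H" using V by (cases ?H) simp
  ultimately have "graph_iso G ?H" unfolding eq by blast
  moreover have "graph_iso H ?H"
    unfolding graph_iso_def using h(1) V edge_relabel_iff[OF H inj] by (intro exI[of _ h]) auto
  ultimately show "graph_iso H G" using graph_iso_trans graph_iso_sym by blast
qed

text \<open>Well-formedness of \<open>C\<close> places both ends of every prescribed non-edge in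
  \<open>S\<close>, where \<open>G\<close> and the induced subgraph have the same edges.\<close>

lemma contains_config_induced:
  assumes "contains_config (induced G S) C" "S \<subseteq> uverts G"
    and "is_configuration C"
  shows "contains_config G C"
proof -
  obtain f where f: "inj_on f (cverts C)" "f ` cverts C \<subseteq> S"
      "\<forall>e\<in>cedges C. f ` e \<in> uedges (induced G S)" "\<forall>e\<in>cnonedges C. f ` e \<notin> uedges (induced G S)"
    using assms(1) by (auto simp: contains_config_def induced_def)
  have "f ` e \<subseteq> S" if "e \<in> cnonedges C" for e
  proof -
    have "e \<subseteq> cverts C" using assms(3) that by (auto simp: is_configuration_def)
    then show ?thesis using f(2) by blast
  qed
  then show ?thesis unfolding contains_config_def
    using f assms(2) by (intro exI[of _ f]) (auto simp: induced_def)
qed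

lemma fin_graph_induced:
  assumes "fin_graph G" "S \<subseteq> uverts G"
  shows "fin_graph (induced G S)"
proof -
  have "\<exists>x y. e = {x, y} \<and> x \<in> S \<and> y \<in> S \<and> x \<noteq> y" if e: "e \<in> uedges G" "e \<subseteq> S" for e
  proof -
    obtain x y where "e = {x, y}" "x \<noteq> y" using assms(1) e(1) unfolding fin_graph_def by blast
    then show ?thesis using e(2) by auto
  qed
  then show ?thesis using assms finite_subset by (auto simp: fin_graph_def induced_def)
qed

lemma config_free_hereditary_unigraph:
  assumes "fin_graph G" "\<forall>C \<in> {config_a, config_b, config_c, config_d}. \<not> contains_config G C"
  shows "hereditary_unigraph G"
  unfolding hereditary_unigraph_def
proof (intro allI impI)
  fix S assume S: "S \<subseteq> uverts G"
  show "unigraph (induced G S)"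
    using fin_graph_induced[OF assms(1) S] assms(2) contains_config_induced[OF
      _ S] is_configuration_abcd
    by (intro config_free_unigraph) auto
qed

section \<open>The forbidden graphs\<close>

text \<open>Trades the list computed by a construction for a short one with a chosen vertex order,
  comparing edges up to orientation and repetition. On concrete lists all hypotheses after the first
  can be evaluated.\<close>

lemma listed_eqI:
  assumes "listed G xs es" "set xs = set ys" "distinct ys"
    "list_all (\<lambda>(x, y). x \<in> set ys \<and> y \<in> set ys \<and> x \<noteq> y \<and> listed_adj es x y) fs"
    "list_all (\<lambda>(x, y). listed_adj fs x y) es"
  shows "listed G ys fs"
proof -
  have "(\<lambda>(x, y). {x, y}) ` set es = (\<lambda>(x, y). {x, y}) ` set fs" (is "?f ` _ = _")
  proof
    show "?f ` set es \<subseteq> ?f ` set fs"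
      using assms(5) by (force simp: list_all_iff listed_adj_def image_iff insert_commute)
    show "?f ` set fs \<subseteq> ?f ` set es"
      using assms(4) by (force simp: list_all_iff listed_adj_def image_iff insert_commute)
  qed
  then show ?thesis using assms by (auto simp: listed_def list_all_iff)
qed

text \<open>The second copy is itself a disjoint union with the empty graph and is thus doubled
  before being moved to the odd numbers: the copies occupy \<open>2 * x\<close> and
  \<open>4 * x + 1\<close>. This is the origin of the labels 1, 5, 9 for the second path in
  \<open>listed_2P3\<close>.\<close>

lemma listed_copies_2:
  assumes "listed G xs es"
  shows "listed (copies 2 G) (map (\<lambda>x. 2 * x) xs @ map (\<lambda>x. 2 * x + 1) (map (\<lambda>x. 2 * x) xs))
    (map (map_prod (\<lambda>x. 2 * x) (\<lambda>x. 2 * x)) es @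
     map (map_prod (\<lambda>x. 2 * x + 1) (\<lambda>x. 2 * x + 1)) (map (map_prod (\<lambda>x. 2 * x) (\<lambda>x. 2 * x)) es))"
  using listed_disj_union[OF assms listed_disj_union[OF assms listed_copies_0]]
  by (simp only: numeral_2_eq_2 copies.simps list.map append_Nil2)

text \<open>The prefix \<open>co_\<close> marks the complement of the graph named after it; both list
  corresponding vertices in the same order.\<close>

lemma listed_P5: "listed (path_graph 5)
    [0, 1, 2, 3, 4]
    [(0, 1), (1, 2), (2, 3), (3, 4)]"
  by (rule listed_eqI[OF listed_path]) code_simp+

lemma listed_co_P5: "listed (complement (path_graph 5))
    [0, 1, 2, 3, 4]
    [(0, 2), (0, 3), (0, 4), (1, 3), (1, 4), (2, 4)]"
  by (rule listed_eqI[OF listed_complement[OF listed_path]]) code_simp+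

lemma listed_K2_K3: "listed (disj_union (complete_graph 2) (complete_graph 3))
    [0, 2, 1, 3, 5]
    [(0, 2), (1, 3), (3, 5), (1, 5)]"
  by (rule listed_eqI[OF listed_disj_union[OF listed_complete listed_complete]]) code_simp+

lemma listed_K23: "listed (complete_bipartite 2 3)
    [0, 1, 2, 3, 4]
    [(0, 2), (0, 3), (0, 4), (1, 2), (1, 3), (1, 4)]"
  by (rule listed_eqI[OF listed_complete_bipartite]) code_simp+

lemma listed_co_4pan: "listed (complement four_pan)
    [0, 1, 2, 3, 4]
    [(0, 2), (1, 3), (1, 4), (2, 4), (3, 4)]"
  by (rule listed_eqI[OF listed_complement[OF listed_four_pan]]) code_simp+

lemma listed_2P3: "listed (copies 2 (path_graph 3))
    [0, 2, 4, 1, 5, 9]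
    [(0, 2), (2, 4), (1, 5), (5, 9)]"
  by (rule listed_eqI[OF listed_copies_2[OF listed_path]]) code_simp+

lemma listed_co_2P3: "listed (join (disj_union (complete_graph 2) (complete_graph 1))
  (disj_union (complete_graph 2) (complete_graph 1)))
    [0, 2, 4, 1, 3, 5]
    [(0, 4), (0, 1), (0, 3), (0, 5), (2, 1), (2, 3), (2, 5), (4, 1), (4, 3), (4, 5), (1, 5)]"
  by (rule listed_eqI[OF listed_join[OF listed_disj_union[OF
    listed_complete listed_complete]
    listed_disj_union[OF listed_complete listed_complete]]]) code_simp+

lemma listed_K2_P4: "listed (disj_union (complete_graph 2) (path_graph 4))
    [0, 2, 1, 3, 5, 7]
    [(0, 2), (1, 3), (3, 5), (5, 7)]"
  by (rule listed_eqI[OF listed_disj_union[OF listed_complete listed_path]]) code_simp+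

lemma listed_co_K2_P4: "listed (join (copies 2 (complete_graph 1)) (path_graph 4))
    [0, 2, 3, 7, 1, 5]
    [(0, 3), (0, 7), (0, 1), (0, 5), (2, 3), (2, 7), (2, 1), (2, 5), (3, 1), (3, 5), (7, 5)]"
  by (rule listed_eqI[OF listed_join[OF listed_copies_2[OF listed_complete]
    listed_path]]) code_simp+

lemma listed_K2_C4: "listed (disj_union (complete_graph 2) (cycle_graph 4))
    [0, 2, 1, 3, 5, 7]
    [(0, 2), (1, 3), (3, 5), (5, 7), (1, 7)]"
  by (rule listed_eqI[OF listed_disj_union[OF
    listed_complete listed_cycle[of 4, simplified]]]) code_simp+

lemma listed_co_K2_C4: "listed (join (copies 2 (complete_graph 1)) (copies 2 (complete_graph 2)))
    [0, 2, 1, 3, 5, 11]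
    [(0, 1), (0, 3), (0, 5), (0, 11), (2, 1), (2, 3), (2, 5), (2, 11), (1, 5), (3, 11)]"
  by (rule listed_eqI[OF listed_join[OF listed_copies_2[OF listed_complete]
    listed_copies_2[OF listed_complete]]]) code_simp+

lemma listed_co_X1: "listed (complement X1)
    [0, 1, 2, 3, 4, 5]
    [(0, 3), (1, 2), (1, 3), (1, 4), (2, 4), (3, 4), (3, 5), (4, 5)]"
  by (rule listed_eqI[OF listed_complement[OF listed_X1]]) code_simp+

lemma listed_co_X2: "listed (complement X2)
    [0, 1, 2, 3, 4, 5]
    [(0, 3), (1, 2), (1, 3), (1, 4), (2, 4), (3, 4), (3, 5)]"
  by (rule listed_eqI[OF listed_complement[OF listed_X2]]) code_simp+

text \<open>This graph is the companion of K2+C4, both having degrees 2, 2, 2, 2, 1, 1. It is absent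
  from \<open>forbidden\<close> because it properly contains an induced K2+K3.\<close>

lemma listed_K3_P3: "listed (disj_union (complete_graph 3) (path_graph 3))
    [0, 2, 4, 1, 3, 5]
    [(0, 2), (0, 4), (2, 4), (1, 3), (3, 5)]"
  by (rule listed_eqI[OF listed_disj_union[OF listed_complete listed_path]]) code_simp+

lemma listed_co_K3_P3: "listed (complement (disj_union (complete_graph 3) (path_graph 3)))
    [0, 2, 4, 1, 3, 5]
    [(0, 1), (0, 3), (0, 5), (2, 1), (2, 3), (2, 5), (4, 1), (4, 3), (4, 5), (1, 5)]"
  by (rule listed_eqI[OF listed_complement[OF listed_disj_union[OF
    listed_complete listed_path]]]) code_simp+

text \<open>Each \<open>D\<close> names end degrees that occur in the first graph of the pair only.
  For instance, \<open>{1}\<close> detects a component K2, and \<open>{1, 3}\<close> detects a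
  pendant vertex attached to a vertex of degree 3.\<close>

lemma forbidden_not_unigraph:
  assumes "H \<in> forbidden" "graph_iso K H"
  shows "\<not> unigraph K"
proof -
  have u1: "\<not> unigraph K" if "graph_iso K (disj_union (complete_graph 2) (complete_graph 3)) \<or>
    graph_iso K (path_graph 5)"
    by (rule nonisomorphic_not_unigraph[OF
      listed_K2_K3 listed_P5 _ _ _ that, where D = "{1}"]) code_simp+
  have u2: "\<not> unigraph K" if "graph_iso K (complement (path_graph 5)) \<or>
    graph_iso K (complete_bipartite 2 3)"
    by (rule nonisomorphic_not_unigraph[OF
      listed_co_P5 listed_K23 _ _ _ that, where D = "{3}"]) code_simp+
  have u3: "\<not> unigraph K" if "graph_iso K four_pan \<or> graph_iso K (complement four_pan)"
    by (rule nonisomorphic_not_unigraph[OF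
      listed_four_pan listed_co_4pan _ _ _ that, where D = "{1, 3}"]) code_simp+
  have u4: "\<not> unigraph K" if "graph_iso K (disj_union (complete_graph 2) (path_graph 4)) \<or>
    graph_iso K (copies 2 (path_graph 3))"
    by (rule nonisomorphic_not_unigraph[OF
      listed_K2_P4 listed_2P3 _ _ _ that, where D = "{1}"]) code_simp+
  have u5: "\<not> unigraph K" if "graph_iso K (join (disj_union (complete_graph 2)
    (complete_graph 1)) (disj_union (complete_graph 2) (complete_graph 1))) \<or>
    graph_iso K (join (copies 2 (complete_graph 1)) (path_graph 4))"
    by (rule nonisomorphic_not_unigraph[OF
      listed_co_2P3 listed_co_K2_P4 _ _ _ that, where D = "{3}"]) code_simp+
  have u6: "\<not> unigraph K" if "graph_iso K (disj_union (complete_graph 2) (cycle_graph 4)) \<or>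
    graph_iso K (disj_union (complete_graph 3) (path_graph 3))"
    by (rule nonisomorphic_not_unigraph[OF
      listed_K2_C4 listed_K3_P3 _ _ _ that, where D = "{1}"]) code_simp+
  have u7: "\<not> unigraph K" if "graph_iso K (complement (disj_union (complete_graph 3)
    (path_graph 3))) \<or> graph_iso K (join (copies 2 (complete_graph 1)) (copies 2
    (complete_graph 2)))"
    by (rule nonisomorphic_not_unigraph[OF
      listed_co_K3_P3 listed_co_K2_C4 _ _ _ that, where D = "{4}"]) code_simp+
  have u8: "\<not> unigraph K" if "graph_iso K X1 \<or> graph_iso K (complement X2)"
    by (rule nonisomorphic_not_unigraph[OF
      listed_X1 listed_co_X2 _ _ _ that, where D = "{1, 3}"]) code_simp+
  have u9: "\<not> unigraph K" if "graph_iso K X2 \<or> graph_iso K (complement X1)"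
    by (rule nonisomorphic_not_unigraph[OF
      listed_X2 listed_co_X1 _ _ _ that, where D = "{1, 3}"]) code_simp+
  show ?thesis
    using assms u1 u2 u3 u4 u5 u6 u7 u8 u9 unfolding forbidden_def by blast
qed

text \<open>Matching \<open>vs\<close> with \<open>ks\<close> by position would be an isomorphism
  onto \<open>K\<close>. Here \<open>sorted_wrt\<close> expresses a condition on all pairs of
  positions i < j, so on explicit lists it unfolds to one edge condition for each pair of
  vertices.\<close>

lemma forbidden_pattern:
  assumes G: "fin_graph G" "graph_free \<F> G" and K: "K \<in> \<F>" "listed K ks es"
    and vs: "distinct vs" "set vs \<subseteq> uverts G" "length vs = length ks"
  shows "\<not> sorted_wrt (\<lambda>(v, k) (w, l). {v, w} \<in> uedges G \<longleftrightarrow> listed_adj es k l) (zip vs ks)"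
proof
  assume *: "sorted_wrt (\<lambda>(v, k) (w, l). {v, w} \<in> uedges G \<longleftrightarrow> listed_adj es k l) (zip vs ks)"
  note ks = listedD[OF K(2)]
  have lt: "{vs ! i, vs ! j} \<in> uedges G \<longleftrightarrow> {ks ! i, ks ! j} \<in> uedges K" if "i < j"
    "j < length vs" for i j
    using sorted_wrt_nth_less[OF * that(1)] that vs(3) by (simp add: ks(3))
  have sing: "{x} \<notin> uedges G" "{k} \<notin> uedges K" for x k
    using G(1) ks(4) by (auto simp: fin_graph_def doubleton_eq_iff)
  have adj: "{vs ! i, vs ! j} \<in> uedges G \<longleftrightarrow> {ks ! i, ks ! j} \<in> uedges K"
    if "i < length vs" "j < length vs" for i j
    using lt[of i j] lt[of j i] that sing
      by (cases i j rule: linorder_cases) (auto simp: insert_commute)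
  define f where "f v = the (map_of (zip vs ks) v)" for v
  have f: "f (vs ! i) = ks ! i" if "i < length vs" for i
    using vs that by (simp add: f_def map_of_zip_nth)
  have "bij_betw f (set vs) (set ks)"
    unfolding bij_betw_def
  proof
    show "inj_on f (set vs)"
      using f vs(3) ks(1) by (auto simp: inj_on_def in_set_conv_nth nth_eq_iff_index_eq)
    show "f ` set vs = set ks"
      using f vs(3) by (force simp: in_set_conv_nth image_iff)
  qed
  moreover have "{x, y} \<in> uedges (induced G (set vs)) \<longleftrightarrow> {f x, f y} \<in> uedges K"
    if "x \<in> set vs" "y \<in> set vs" for x y
    using that adj f by (auto simp: induced_def in_set_conv_nth)
  ultimately have "graph_iso (induced G (set vs)) K"
    unfolding graph_iso_def by (intro exI[of _ f]) (auto simp: induced_def ks(2))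
  then show False using G(2) vs(2) K(1) unfolding graph_free_def by blast
qed

text \<open>Only pr and qs are unconstrained. The four completions are P5, the 4-pan twice (related
  by reversing p, q, w, r, s) and K_{2,3}.\<close>

lemma forbidden_free_config_a:
  assumes G: "fin_graph G" "graph_free forbidden G"
  shows "\<not> contains_config G config_a"
proof
  let ?E = "uedges G"
  assume "contains_config G config_a"
  then obtain p q r s w where V: "{p, q, r, s, w} \<subseteq> uverts G" "distinct [p, q, r, s, w]"
    and E: "{p, q} \<in> ?E" "{r, s} \<in> ?E" "{q, w} \<in> ?E" "{r, w} \<in> ?E" "{q, r} \<notin> ?E" "{p, s} \<notin> ?E"
      "{p, w} \<notin> ?E" "{s, w} \<notin> ?E"
    unfolding contains_config_simps by (elim exE conjE, intro that)
  have 1: "\<not> ({p, r} \<notin> ?E \<and> {q, s} \<notin> ?E)"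
    using forbidden_pattern[OF G _ listed_P5, of "[p, q, w, r, s]"] V E
    by (auto simp: forbidden_def listed_adj_def insert_commute)
  have 2: "\<not> ({p, r} \<notin> ?E \<and> {q, s} \<in> ?E)"
    using forbidden_pattern[OF G _ listed_four_pan, of "[q, s, r, w, p]"] V E
    by (auto simp: forbidden_def listed_adj_def insert_commute)
  have 3: "\<not> ({p, r} \<in> ?E \<and> {q, s} \<notin> ?E)"
    using forbidden_pattern[OF G _ listed_four_pan, of "[r, p, q, w, s]"] V E
    by (auto simp: forbidden_def listed_adj_def insert_commute)
  have 4: "\<not> ({p, r} \<in> ?E \<and> {q, s} \<in> ?E)"
    using forbidden_pattern[OF G _ listed_K23, of "[q, r, p, s, w]"] V E
    by (auto simp: forbidden_def listed_adj_def insert_commute)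
  show False using 1 2 3 4 by blast
qed

text \<open>Again only pr and qs are free. The completions K2+K3, co-4-pan (twice) and house are the
  complements of those of (a).\<close>

lemma forbidden_free_config_b:
  assumes G: "fin_graph G" "graph_free forbidden G"
  shows "\<not> contains_config G config_b"
proof
  let ?E = "uedges G"
  assume "contains_config G config_b"
  then obtain p q r s w where V: "{p, q, r, s, w} \<subseteq> uverts G" "distinct [p, q, r, s, w]"
    and E: "{p, q} \<in> ?E" "{r, s} \<in> ?E" "{p, w} \<in> ?E" "{q, w} \<in> ?E" "{q, r} \<notin> ?E" "{p, s} \<notin> ?E"
      "{r, w} \<notin> ?E" "{s, w} \<notin> ?E"
    unfolding contains_config_simps by (elim exE conjE, intro that)
  have 1: "\<not> ({p, r} \<notin> ?E \<and> {q, s} \<notin> ?E)"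
    using forbidden_pattern[OF G _ listed_K2_K3, of "[r, s, p, q, w]"] V E
    by (auto simp: forbidden_def listed_adj_def insert_commute)
  have 2: "\<not> ({p, r} \<notin> ?E \<and> {q, s} \<in> ?E)"
    using forbidden_pattern[OF G _ listed_co_4pan, of "[r, p, s, w, q]"] V E
    by (auto simp: forbidden_def listed_adj_def insert_commute)
  have 3: "\<not> ({p, r} \<in> ?E \<and> {q, s} \<notin> ?E)"
    using forbidden_pattern[OF G _ listed_co_4pan, of "[s, q, r, w, p]"] V E
    by (auto simp: forbidden_def listed_adj_def insert_commute)
  have 4: "\<not> ({p, r} \<in> ?E \<and> {q, s} \<in> ?E)"
    using forbidden_pattern[OF G _ listed_co_P5, of "[p, s, w, r, q]"] V E
    by (auto simp: forbidden_def listed_adj_def insert_commute)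
  show False using 1 2 3 4 by blast
qed

lemma no_config_a:
  assumes "fin_graph G" "graph_free forbidden G" "distinct [p, q, r, s, w]"
    "{p, q, r, s, w} \<subseteq> uverts G"
  shows "\<not> ({p, q} \<in> uedges G \<and> {r, s} \<in> uedges G \<and> {q, w} \<in> uedges G \<and> {r, w} \<in> uedges G \<and>
     {q, r} \<notin> uedges G \<and> {p, s} \<notin> uedges G \<and> {p, w} \<notin> uedges G \<and> {s, w} \<notin> uedges G)"
  using forbidden_free_config_a[OF assms(1,2)] assms(3,4) unfolding contains_config_simps by blast

lemma no_config_b:
  assumes "fin_graph G" "graph_free forbidden G" "distinct [p, q, r, s, w]"
    "{p, q, r, s, w} \<subseteq> uverts G"
  shows "\<not> ({p, q} \<in> uedges G \<and> {r, s} \<in> uedges G \<and> {p, w} \<in> uedges G \<and> {q, w} \<in> uedges G \<and>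
     {q, r} \<notin> uedges G \<and> {p, s} \<notin> uedges G \<and> {r, w} \<notin> uedges G \<and> {s, w} \<notin> uedges G)"
  using forbidden_free_config_b[OF assms(1,2)] assms(3,4) unfolding contains_config_simps by blast

text \<open>Seven vertex pairs of (c) and of (d) are unconstrained; each clause below excludes those of
  the 128 completions in which the listed vertices induce the named forbidden graph or form a
  configuration (a) or (b), and together the clauses exclude them all.\<close>

lemma forbidden_free_config_c:
  assumes G: "fin_graph G" "graph_free forbidden G"
  shows "\<not> contains_config G config_c"
proof
  let ?E = "uedges G"
  assume "contains_config G config_c"
  then obtain p q r s y z where V: "{p, q, r, s, y, z} \<subseteq> uverts G" "distinct [p, q, r, s, y, z]"
    and E: "{p, q} \<in> ?E" "{r, s} \<in> ?E" "{p, z} \<in> ?E" "{q, y} \<in> ?E" "{q, r} \<notin> ?E" "{p, s} \<notin> ?E"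
      "{r, z} \<notin> ?E" "{s, y} \<notin> ?E"
    unfolding contains_config_simps by (elim exE conjE, intro that)
  \<comment> \<open>Clauses 1 to 8 force py, ry, pr to be all edges or all non-edges, and likewise
    qz, sz, qs. These two choices and yz leave eight completions, one for each of the clauses 9 to
    16.\<close>
  have 1: "\<not> ({p, y} \<notin> ?E \<and> {r, y} \<in> ?E)"
    using no_config_a[OF G, of p q r s y] V E by (auto simp: insert_commute)
  have 2: "\<not> ({p, y} \<in> ?E \<and> {r, y} \<notin> ?E)"
    using no_config_b[OF G, of p q r s y] V E by (auto simp: insert_commute)
  have 3: "\<not> ({q, z} \<notin> ?E \<and> {s, z} \<in> ?E)"
    using no_config_a[OF G, of q p s r z] V E by (auto simp: insert_commute)
  have 4: "\<not> ({q, z} \<in> ?E \<and> {s, z} \<notin> ?E)"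
    using no_config_b[OF G, of p q r s z] V E by (auto simp: insert_commute)
  have 5: "\<not> ({q, s} \<in> ?E \<and> {q, z} \<notin> ?E)"
    using no_config_a[OF G, of r s p z q] V E by (auto simp: insert_commute)
  have 6: "\<not> ({q, s} \<notin> ?E \<and> {q, z} \<in> ?E)"
    using no_config_b[OF G, of p z r s q] V E by (auto simp: insert_commute)
  have 7: "\<not> ({p, r} \<in> ?E \<and> {p, y} \<notin> ?E)"
    using no_config_a[OF G, of s r q y p] V E by (auto simp: insert_commute)
  have 8: "\<not> ({p, r} \<notin> ?E \<and> {p, y} \<in> ?E)"
    using no_config_b[OF G, of q y s r p] V E by (auto simp: insert_commute)
  \<comment> \<open>The completion met here is the complement of the path on six vertices, which
    already contains a smaller forbidden graph, the house.\<close>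
  have 9: "\<not> ({p, r} \<in> ?E \<and> {p, y} \<in> ?E \<and> {r, y} \<in> ?E \<and> {s, z} \<in> ?E \<and> {y, z} \<notin> ?E)"
    using no_config_b[OF G, of p r z s y] V E by (auto simp: insert_commute)
  have 10: "\<not> ({p, r} \<notin> ?E \<and> {p, y} \<notin> ?E \<and> {q, s} \<notin> ?E \<and> {q, z} \<notin> ?E \<and> {r, y} \<notin> ?E \<and>
    {s, z} \<notin> ?E \<and> {y, z} \<notin> ?E)"
    using forbidden_pattern[OF G _ listed_K2_P4, of "[r, s, y, q, p, z]"] V E
    by (auto simp: forbidden_def listed_adj_def insert_commute)
  have 11: "\<not> ({p, r} \<notin> ?E \<and> {p, y} \<notin> ?E \<and> {q, s} \<notin> ?E \<and> {q, z} \<notin> ?E \<and> {r, y} \<notin> ?E \<and>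
    {s, z} \<notin> ?E \<and> {y, z} \<in> ?E)"
    using forbidden_pattern[OF G _ listed_K2_C4, of "[r, s, p, q, y, z]"] V E
    by (auto simp: forbidden_def listed_adj_def insert_commute)
  \<comment> \<open>With \<open>z\<close>, \<open>y\<close> in the roles of t, u this completion is
    X1 itself, and adding yz gives X2. Clauses 13 and 15 are the mirror images under exchanging p
    with q, r with s and y with z.\<close>
  have 12: "\<not> ({p, r} \<in> ?E \<and> {p, y} \<in> ?E \<and> {q, s} \<notin> ?E \<and> {q, z} \<notin> ?E \<and> {r, y} \<in> ?E \<and>
    {s, z} \<notin> ?E \<and> {y, z} \<notin> ?E)"
    using forbidden_pattern[OF G _ listed_X1, of "[p, q, r, s, z, y]"] V E
    by (auto simp: forbidden_def listed_adj_def insert_commute)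
  have 13: "\<not> ({p, r} \<notin> ?E \<and> {p, y} \<notin> ?E \<and> {q, s} \<in> ?E \<and> {q, z} \<in> ?E \<and> {r, y} \<notin> ?E \<and>
    {s, z} \<in> ?E \<and> {y, z} \<notin> ?E)"
    using forbidden_pattern[OF G _ listed_X1, of "[q, p, s, r, y, z]"] V E
    by (auto simp: forbidden_def listed_adj_def insert_commute)
  have 14: "\<not> ({p, r} \<in> ?E \<and> {p, y} \<in> ?E \<and> {q, s} \<notin> ?E \<and> {q, z} \<notin> ?E \<and> {r, y} \<in> ?E \<and>
    {s, z} \<notin> ?E \<and> {y, z} \<in> ?E)"
    using forbidden_pattern[OF G _ listed_X2, of "[p, q, r, s, z, y]"] V E
    by (auto simp: forbidden_def listed_adj_def insert_commute)
  have 15: "\<not> ({p, r} \<notin> ?E \<and> {p, y} \<notin> ?E \<and> {q, s} \<in> ?E \<and> {q, z} \<in> ?E \<and> {r, y} \<notin> ?E \<and>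
    {s, z} \<in> ?E \<and> {y, z} \<in> ?E)"
    using forbidden_pattern[OF G _ listed_X2, of "[q, p, s, r, y, z]"] V E
    by (auto simp: forbidden_def listed_adj_def insert_commute)
  have 16: "\<not> ({p, r} \<in> ?E \<and> {p, y} \<in> ?E \<and> {q, s} \<in> ?E \<and> {q, z} \<in> ?E \<and> {r, y} \<in> ?E \<and>
    {s, z} \<in> ?E \<and> {y, z} \<in> ?E)"
    using forbidden_pattern[OF G _ listed_co_2P3, of "[p, s, y, q, r, z]"] V E
    by (auto simp: forbidden_def listed_adj_def insert_commute)
  show False using 1 2 3 4 5 6 7 8 9 10 11 12 13 14 15 16 by blast
qed

lemma forbidden_free_config_d:
  assumes G: "fin_graph G" "graph_free forbidden G"
  shows "\<not> contains_config G config_d"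
proof
  let ?E = "uedges G"
  assume "contains_config G config_d"
  then obtain p q r s y z where V: "{p, q, r, s, y, z} \<subseteq> uverts G" "distinct [p, q, r, s, y, z]"
    and E: "{p, q} \<in> ?E" "{r, s} \<in> ?E" "{r, y} \<in> ?E" "{q, z} \<in> ?E" "{q, r} \<notin> ?E" "{p, s} \<notin> ?E"
      "{p, y} \<notin> ?E" "{s, z} \<notin> ?E"
    unfolding contains_config_simps by (elim exE conjE, intro that)
  \<comment> \<open>Here clauses 1 to 8 tie qy, sy, qs together and likewise pz, rz, pr; with yz,
    eight completions remain for clauses 9 to 16.\<close>
  have 1: "\<not> ({q, y} \<in> ?E \<and> {s, y} \<notin> ?E)"
    using no_config_a[OF G, of p q r s y] V E by (auto simp: insert_commute)
  have 2: "\<not> ({q, y} \<notin> ?E \<and> {s, y} \<in> ?E)"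
    using no_config_b[OF G, of r s p q y] V E by (auto simp: insert_commute)
  have 3: "\<not> ({p, z} \<notin> ?E \<and> {r, z} \<in> ?E)"
    using no_config_a[OF G, of p q r s z] V E by (auto simp: insert_commute)
  have 4: "\<not> ({p, z} \<in> ?E \<and> {r, z} \<notin> ?E)"
    using no_config_b[OF G, of p q r s z] V E by (auto simp: insert_commute)
  have 5: "\<not> ({q, s} \<in> ?E \<and> {s, y} \<notin> ?E)"
    using no_config_a[OF G, of p q r y s] V E by (auto simp: insert_commute)
  have 6: "\<not> ({q, s} \<notin> ?E \<and> {s, y} \<in> ?E)"
    using no_config_b[OF G, of r y p q s] V E by (auto simp: insert_commute)
  have 7: "\<not> ({p, r} \<in> ?E \<and> {p, z} \<notin> ?E)"
    using no_config_a[OF G, of s r q z p] V E by (auto simp: insert_commute)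
  have 8: "\<not> ({p, r} \<notin> ?E \<and> {p, z} \<in> ?E)"
    using no_config_b[OF G, of q z s r p] V E by (auto simp: insert_commute)
  \<comment> \<open>The completion left here is the path p, q, z, y, r, s, which contains an induced
    P5.\<close>
  have 9: "\<not> ({p, r} \<notin> ?E \<and> {p, z} \<notin> ?E \<and> {q, y} \<notin> ?E \<and> {r, z} \<notin> ?E \<and> {y, z} \<in> ?E)"
    using no_config_a[OF G, of p q y r z] V E by (auto simp: insert_commute)
  have 10: "\<not> ({p, r} \<notin> ?E \<and> {p, z} \<notin> ?E \<and> {q, s} \<notin> ?E \<and> {q, y} \<notin> ?E \<and> {r, z} \<notin> ?E \<and>
    {s, y} \<notin> ?E \<and> {y, z} \<notin> ?E)"
    using forbidden_pattern[OF G _ listed_2P3, of "[p, q, z, s, r, y]"] V E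
    by (auto simp: forbidden_def listed_adj_def insert_commute)
  have 11: "\<not> ({p, r} \<in> ?E \<and> {p, z} \<in> ?E \<and> {q, s} \<in> ?E \<and> {q, y} \<in> ?E \<and> {r, z} \<in> ?E \<and>
    {s, y} \<in> ?E \<and> {y, z} \<in> ?E)"
    using forbidden_pattern[OF G _ listed_co_K2_P4, of "[q, r, y, p, s, z]"] V E
    by (auto simp: forbidden_def listed_adj_def insert_commute)
  have 12: "\<not> ({p, r} \<in> ?E \<and> {p, z} \<in> ?E \<and> {q, s} \<in> ?E \<and> {q, y} \<in> ?E \<and> {r, z} \<in> ?E \<and>
    {s, y} \<in> ?E \<and> {y, z} \<notin> ?E)"
    using forbidden_pattern[OF G _ listed_co_K2_C4, of "[q, r, p, s, z, y]"] V E
    by (auto simp: forbidden_def listed_adj_def insert_commute)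
  have 13: "\<not> ({p, r} \<notin> ?E \<and> {p, z} \<notin> ?E \<and> {q, s} \<in> ?E \<and> {q, y} \<in> ?E \<and> {r, z} \<notin> ?E \<and>
    {s, y} \<in> ?E \<and> {y, z} \<in> ?E)"
    using forbidden_pattern[OF G _ listed_co_X1, of "[p, s, r, q, y, z]"] V E
    by (auto simp: forbidden_def listed_adj_def insert_commute)
  have 14: "\<not> ({p, r} \<in> ?E \<and> {p, z} \<in> ?E \<and> {q, s} \<notin> ?E \<and> {q, y} \<notin> ?E \<and> {r, z} \<in> ?E \<and>
    {s, y} \<notin> ?E \<and> {y, z} \<in> ?E)"
    using forbidden_pattern[OF G _ listed_co_X1, of "[s, p, q, r, z, y]"] V E
    by (auto simp: forbidden_def listed_adj_def insert_commute)
  have 15: "\<not> ({p, r} \<notin> ?E \<and> {p, z} \<notin> ?E \<and> {q, s} \<in> ?E \<and> {q, y} \<in> ?E \<and> {r, z} \<notin> ?E \<and>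
    {s, y} \<in> ?E \<and> {y, z} \<notin> ?E)"
    using forbidden_pattern[OF G _ listed_co_X2, of "[p, s, r, q, y, z]"] V E
    by (auto simp: forbidden_def listed_adj_def insert_commute)
  have 16: "\<not> ({p, r} \<in> ?E \<and> {p, z} \<in> ?E \<and> {q, s} \<notin> ?E \<and> {q, y} \<notin> ?E \<and> {r, z} \<in> ?E \<and>
    {s, y} \<notin> ?E \<and> {y, z} \<notin> ?E)"
    using forbidden_pattern[OF G _ listed_co_X2, of "[s, p, q, r, z, y]"] V E
    by (auto simp: forbidden_def listed_adj_def insert_commute)
  show False using 1 2 3 4 5 6 7 8 9 10 11 12 13 14 15 16 by blast
qed

theorem theorem4p2:
  fixes G :: "'a ugraph"
  assumes "fin_graph G"
  shows "(hereditary_unigraph G \<longleftrightarrow> (\<forall>C \<in> {config_a, config_b, config_c, config_d}. \<not> contains_config G C))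
    \<and> (hereditary_unigraph G \<longleftrightarrow> graph_free forbidden G)"
proof -
  have "graph_free forbidden G" if "hereditary_unigraph G"
    using that forbidden_not_unigraph unfolding hereditary_unigraph_def graph_free_def by blast
  moreover have "\<forall>C \<in> {config_a, config_b, config_c, config_d}. \<not> contains_config G C"
    if "graph_free forbidden G"
    using assms that forbidden_free_config_a forbidden_free_config_b forbidden_free_config_c
      forbidden_free_config_d by blast
  moreover have "hereditary_unigraph G"
    if "\<forall>C \<in> {config_a, config_b, config_c, config_d}. \<not> contains_config G C"
    using assms that by (rule config_free_hereditary_unigraph)
  ultimately show ?thesis by blast
qed

end
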